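(* Let $n>m\ge 1$ and $s\ge 1$ be integers and let $A\in\mathbb Z^{m\times n}$ be a matrix such that (i) the greatest common divisor of all $m\times m$ minors of $A$ is $1$, and (ii) $\{\boldsymbol x\in\mathbb R^n_{\ge 0}:A\boldsymbol x=\boldsymbol 0\}=\{\boldsymbol 0\}$. Then $$\mathrm g_s(A)\le\frac{n-m}{2}\sqrt{\det(AA^\intercal)}+\frac{(s-1)^{\frac1{n-m}}}{2}\left(\sqrt{\det(AA^\intercal)}\right)^{\frac1{n-m}} .$$
   Context: For $\boldsymbol b\in\mathbb Z^m$ let $P(A,\boldsymbol b)=\{\boldsymbol x\in\mathbb R^n_{\ge 0}:A\boldsymbol x=\boldsymbol b\}$, and let $\mathcal F_s(A)=\{\boldsymbol b\in\mathbb Z^m:\#(P(A,\boldsymbol b)\cap\mathbb Z^n)\ge s\}$. Let $C\subset\mathbb R^m$ be the convex cone generated by the columns of $A$ and $\boldsymbol v=A\boldsymbol 1$, where $\boldsymbol 1\in\mathbb Z^n$ is the all-ones vector. The diagonal $s$-Frobenius number of $A$ is $$\mathrm g_s(A)=\min\{t\in\mathbb R_{\ge 0}:\ \mathrm{int}(t\boldsymbol v+C)\cap\mathbb Z^m\subseteq\mathcal F_s(A)\}.$$ *)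

theory Defs
  imports "HOL-Analysis.Analysis"
begin

text \<open>
  An integer \<open>m \<times> n\<close> matrix is an element of \<open>int ^ 'n ^ 'm\<close>, with \<open>m = CARD('m)\<close> and
  \<open>n = CARD('n)\<close>. The lattice \<open>\<int>\<^sup>k\<close> is regarded as a subset of \<open>\<real>\<^sup>k\<close>.
\<close>

abbreviation real_matrix :: "int ^ 'n ^ 'm \<Rightarrow> real ^ 'n ^ 'm" where
  "real_matrix A \<equiv> map_matrix real_of_int A"

definition int_vecs :: "(real ^ 'k) set" where
  "int_vecs = {x. \<forall>i. x $ i \<in> \<int>}"

text \<open>
  The index type of the columns carries no order, so the columns of a maximal submatrix are selected
  by an injection. Each minor therefore occurs with both signs (if \<open>m \<ge> 2\<close>), which does not affect
  the greatest common divisor.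
\<close>

definition maximal_minors :: "int ^ 'n ^ 'm \<Rightarrow> int set" where
  "maximal_minors A = {det (\<chi> i j. A $ i $ f j) |f :: 'm \<Rightarrow> 'n. inj f}"

definition fiber_polyhedron :: "int ^ 'n ^ 'm \<Rightarrow> real ^ 'm \<Rightarrow> (real ^ 'n) set" where
  "fiber_polyhedron A b = {x. (\<forall>j. 0 \<le> x $ j) \<and> real_matrix A *v x = b}"

text \<open>The case of infinitely many lattice points is separate because \<open>card\<close> is \<open>0\<close> there.\<close>

definition feasible_set :: "nat \<Rightarrow> int ^ 'n ^ 'm \<Rightarrow> (real ^ 'm) set" where
  "feasible_set s A =
    {b \<in> int_vecs. infinite (fiber_polyhedron A b \<inter> int_vecs) \<or>
                   s \<le> card (fiber_polyhedron A b \<inter> int_vecs)}"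

definition column_cone :: "int ^ 'n ^ 'm \<Rightarrow> (real ^ 'm) set" where
  "column_cone A = convex_cone hull (columns (real_matrix A))"

text \<open>
  The vector \<open>1\<close> is the all-ones vector. \<open>Least\<close> is a genuine minimum: its value is unspecified
  unless the minimum exists.
\<close>

definition diagonal_frobenius :: "nat \<Rightarrow> int ^ 'n ^ 'm \<Rightarrow> real" where
  "diagonal_frobenius s A =
    (LEAST t. 0 \<le> t \<and>
      interior ((\<lambda>x. t *\<^sub>R (real_matrix A *v 1) + x) ` column_cone A) \<inter> int_vecs
        \<subseteq> feasible_set s A)"

end

theory Submission
  imports Defs "HOL-Probability.Probability"
begin

text \<open>
  Write \<open>d = n - m\<close>, \<open>D = sqrt (det (A A\<^sup>T))\<close>, and let \<open>\<Lambda>\<close> be the lattice of integer points in the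
  kernel \<open>L\<close> of \<open>A\<close>. If \<open>b\<close> lies in the interior of \<open>t v + C\<close>, then \<open>b = A x\<close> with all coordinates of \<open>x\<close>
  larger than \<open>t\<close>, so it suffices to find \<open>s\<close> points of a translate of \<open>\<Lambda>\<close> in the slice of the cube
  \<open>[-t, t]\<^sup>n\<close> by \<open>L\<close>. The circuits of \<open>A\<close> given by Cramer's rule are \<open>d\<close> independent vectors of \<open>\<Lambda>\<close> whose
  entries are maximal minors, hence at most \<open>D\<close> by Cauchy-Binet; rounding along them moves any
  point of \<open>L\<close> into \<open>\<Lambda>\<close> at distance at most \<open>d D / 2\<close> in the maximum norm. The second term of
  the bound comes from Blichfeldt's argument: if \<open>(2 r)\<^sup>d > (s - 1) D\<close>, some translate of the slice of
  \<open>[-r, r]\<^sup>n\<close> contains \<open>s\<close> points of \<open>\<Lambda>\<close>, because by Vaaler's theorem the slice of the unit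
  cube has volume at least \<open>1\<close>. Instead of slices, thin slabs around \<open>L\<close> are measured
  in \<open>\<real>\<^sup>n\<close>. Vaaler's inequality is proved by replacing the uniform density on \<open>[-1/2, 1/2]\<close> by the
  density \<open>exp (- \<pi> x\<^sup>2)\<close> one coordinate at a time; each step decreases the measure of a symmetric convex
  set, since by the Prekopa-Leindler inequality the measures of its sections are unimodal.
\<close>

section \<open>Maximal minors and kernel lattices\<close>

lemma det_map_matrix_of_int:
  fixes M :: "int ^ 'k ^ 'k"
  shows "det (real_matrix M) = real_of_int (det M)"
  by (simp add: det_def map_matrix_def)

text \<open>Half of the Cauchy-Binet formula: the entries of the Gram matrix are multiplied out over
  all column choices \<open>f\<close>, and the sum over permutations that is left over is the
  determinant of the chosen columns. Non-injective choices may stay, as their determinant has two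
  equal columns.\<close>

lemma det_gram_eq_sum:
  fixes A :: "'a::comm_ring_1 ^ 'n ^ 'm"
  shows "det (A ** transpose A) =
    (\<Sum>f\<in>(UNIV :: ('m \<Rightarrow> 'n) set). (\<Prod>i\<in>UNIV. A $ i $ f i) * det (\<chi> i j. A $ i $ f j))"
proof -
  let ?P = "{p. p permutes (UNIV :: 'm set)}"
  have "det (A ** transpose A) =
      (\<Sum>p\<in>?P. of_int (sign p) * (\<Prod>i\<in>UNIV. \<Sum>k\<in>UNIV. A $ i $ k * A $ p i $ k))"
    by (simp add: det_def matrix_matrix_mult_def transpose_def)
  also have "\<dots> = (\<Sum>p\<in>?P. \<Sum>f\<in>(UNIV :: ('m \<Rightarrow> 'n) set).
      of_int (sign p) * ((\<Prod>i\<in>UNIV. A $ i $ f i) * (\<Prod>i\<in>UNIV. A $ p i $ f i)))"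
    by (simp add: prod_sum_PiE PiE_UNIV_domain sum_distrib_left prod.distrib)
  also have "\<dots> = (\<Sum>f\<in>(UNIV :: ('m \<Rightarrow> 'n) set).
      (\<Prod>i\<in>UNIV. A $ i $ f i) * (\<Sum>p\<in>?P. of_int (sign p) * (\<Prod>i\<in>UNIV. A $ p i $ f i)))"
    by (subst sum.swap) (simp add: sum_distrib_left algebra_simps)
  also have "\<dots> = (\<Sum>f\<in>UNIV. (\<Prod>i\<in>UNIV. A $ i $ f i) * det (transpose (\<chi> i j. A $ i $ f j)))"
    by (simp add: det_def transpose_def)
  finally show ?thesis by (simp add: det_transpose)
qed

text \<open>Reindexing the preceding sum by \<open>f \<circ> p\<close> and adding up over all
  \<open>p\<close> turns the remaining product of entries into a second copy of the minor. The
  factorial appears because every set of columns is counted once for each of its orderings.\<close>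

lemma fact_mult_det_gram:
  fixes A :: "'a::comm_ring_1 ^ 'n ^ 'm"
  shows "of_nat (fact CARD('m)) * det (A ** transpose A) =
    (\<Sum>f\<in>(UNIV :: ('m \<Rightarrow> 'n) set). (det (\<chi> i j. A $ i $ f j))\<^sup>2)"
proof -
  let ?P = "{p. p permutes (UNIV :: 'm set)}"
  let ?D = "\<lambda>f :: 'm \<Rightarrow> 'n. det (\<chi> i j. A $ i $ f j)"
  have perm: "det (A ** transpose A) =
      (\<Sum>f\<in>UNIV. of_int (sign p) * (\<Prod>i\<in>UNIV. A $ i $ f (p i)) * ?D f)" if "p \<in> ?P" for p
  proof -
    have bp: "bij p" using that by (simp add: permutes_bij)
    have D: "?D (f \<circ> p) = of_int (sign p) * ?D f" for f
      using det_permute_columns[of p "\<chi> i j. A $ i $ f j"] that by simp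
    have "bij_betw (\<lambda>f :: 'm \<Rightarrow> 'n. f \<circ> p) UNIV UNIV"
      by (rule bij_betw_byWitness[where f' = "\<lambda>f. f \<circ> inv p"])
         (use bp in \<open>auto simp: fun_eq_iff bij_is_inj bij_is_surj surj_f_inv_f\<close>)
    then have "det (A ** transpose A) =
        (\<Sum>f\<in>UNIV. (\<Prod>i\<in>UNIV. A $ i $ (f \<circ> p) i) * ?D (f \<circ> p))"
      unfolding det_gram_eq_sum by (rule sum.reindex_bij_betw[symmetric])
    then show ?thesis unfolding D by (simp add: algebra_simps)
  qed
  have "of_nat (fact CARD('m)) * det (A ** transpose A) = (\<Sum>p\<in>?P. det (A ** transpose A))"
    by (simp add: card_permutations)
  also have "\<dots> = (\<Sum>p\<in>?P. \<Sum>f\<in>UNIV. of_int (sign p) * (\<Prod>i\<in>UNIV. A $ i $ f (p i)) * ?D f)"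
    by (rule sum.cong) (use perm in auto)
  also have "\<dots> = (\<Sum>f\<in>UNIV. (\<Sum>p\<in>?P. of_int (sign p) * (\<Prod>i\<in>UNIV. A $ i $ f (p i))) * ?D f)"
    by (subst sum.swap) (simp add: sum_distrib_right)
  also have "\<dots> = (\<Sum>f\<in>UNIV. (?D f)\<^sup>2)"
    by (simp add: det_def power2_eq_square)
  finally show ?thesis .
qed

text \<open>All reorderings \<open>f \<circ> p\<close> have the same squared minor, and by
  injectivity of \<open>f\<close> they are distinct terms of the preceding sum of squares; the
  factorial cancels.\<close>

lemma minor_squared_le_det_gram:
  fixes A :: "'a::linordered_idom ^ 'n ^ 'm" and f :: "'m \<Rightarrow> 'n"
  assumes "inj f"
  shows "(det (\<chi> i j. A $ i $ f j))\<^sup>2 \<le> det (A ** transpose A)"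
proof -
  let ?P = "{p. p permutes (UNIV :: 'm set)}"
  let ?D = "\<lambda>f :: 'm \<Rightarrow> 'n. det (\<chi> i j. A $ i $ f j)"
  have D: "(?D (f \<circ> p))\<^sup>2 = (?D f)\<^sup>2" if "p \<in> ?P" for p
  proof -
    have "?D (f \<circ> p) = of_int (sign p) * ?D f"
      using det_permute_columns[of p "\<chi> i j. A $ i $ f j"] that by simp
    then show ?thesis by (simp add: sign_def)
  qed
  have inj: "inj_on (\<lambda>p. f \<circ> p) ?P"
    using assms by (auto simp: inj_on_def fun_eq_iff)
  have "of_nat (fact CARD('m)) * (?D f)\<^sup>2 = (\<Sum>p\<in>?P. (?D (f \<circ> p))\<^sup>2)"
    using D by (simp add: card_permutations)
  also have "\<dots> = (\<Sum>g\<in>(\<lambda>p. f \<circ> p) ` ?P. (?D g)\<^sup>2)"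
    by (simp add: sum.reindex[OF inj])
  also have "\<dots> \<le> (\<Sum>g\<in>UNIV. (?D g)\<^sup>2)"
    by (rule sum_mono2) auto
  also have "\<dots> = of_nat (fact CARD('m)) * det (A ** transpose A)"
    by (rule fact_mult_det_gram[symmetric])
  finally show ?thesis
    by (simp add: mult_le_cancel_left)
qed

text \<open>Cramer's rule with the denominator cleared. It is derived over the reals, where division
  by the determinant is possible, and read back in the integers.\<close>

lemma cramer_of_int:
  fixes M :: "int ^ 'k ^ 'k" and c :: "int ^ 'k"
  assumes "det M \<noteq> 0"
  shows "M *v (\<chi> k. det (\<chi> i j. if j = k then c $ i else M $ i $ j)) = det M *s c"
proof -
  let ?w = "\<lambda>k. det (\<chi> i j. if j = k then c $ i else M $ i $ j)"
  let ?R = "real_matrix M" and ?c = "\<chi> i. real_of_int (c $ i)"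
  have dR: "det ?R = real_of_int (det M)" by (rule det_map_matrix_of_int)
  have w: "det (\<chi> i j. if j = k then ?c $ i else ?R $ i $ j) = real_of_int (?w k)" for k
    by (subst det_map_matrix_of_int[symmetric])
       (rule arg_cong[where f = det], simp add: vec_eq_iff map_matrix_def)
  have "?R *v (\<chi> k. real_of_int (?w k) / real_of_int (det M)) = ?c"
    using cramer[of ?R _ ?c] assms unfolding dR w by simp
  then have "(\<Sum>k\<in>UNIV. real_of_int (M $ i $ k) * (real_of_int (?w k) / real_of_int (det M)))
      = real_of_int (c $ i)" for i
    by (simp add: vec_eq_iff matrix_vector_mult_def map_matrix_def)
  then have "(\<Sum>k\<in>UNIV. real_of_int (M $ i $ k) * real_of_int (?w k)) / real_of_int (det M)
      = real_of_int (c $ i)" for i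
    by (simp add: sum_divide_distrib)
  then have "(\<Sum>k\<in>UNIV. real_of_int (M $ i $ k) * real_of_int (?w k))
      = real_of_int (det M * c $ i)" for i
    using assms by (simp add: field_simps)
  then have "(\<Sum>k\<in>UNIV. M $ i $ k * ?w k) = det M * c $ i" for i
    by (simp flip: of_int_mult of_int_sum)
  then show ?thesis by (simp add: vec_eq_iff matrix_vector_mult_def)
qed

lemma matrix_vector_mult_supported:
  fixes A :: "'a::comm_ring_1 ^ 'n ^ 'm" and z :: "'a ^ 'n" and f :: "'k::finite \<Rightarrow> 'n"
  assumes "inj f" "\<And>j. j \<notin> range f \<Longrightarrow> z $ j = 0"
  shows "A *v z = (\<chi> i j. A $ i $ f j) *v (\<chi> j. z $ f j)"
proof -
  have "(\<Sum>j\<in>UNIV. A $ i $ j * z $ j) = (\<Sum>j\<in>UNIV. A $ i $ f j * z $ f j)" for i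
  proof -
    have "(\<Sum>j\<in>UNIV. A $ i $ j * z $ j) = (\<Sum>j\<in>range f. A $ i $ j * z $ j)"
      by (rule sum.mono_neutral_right) (use assms in auto)
    then show ?thesis using assms(1) by (simp add: sum.reindex)
  qed
  then show ?thesis by (simp add: vec_eq_iff matrix_vector_mult_def)
qed

text \<open>A subgroup of the integers other than zero consists of the multiples of its least
  positive element \<open>g\<close>. Hence \<open>g\<close> divides every element of
  \<open>S\<close> and so \<open>Gcd S\<close>, also if \<open>S\<close> is infinite.\<close>

lemma Gcd_int_mem_subgroup:
  fixes G S :: "int set"
  assumes diff: "\<And>a b. a \<in> G \<Longrightarrow> b \<in> G \<Longrightarrow> a - b \<in> G" and "0 \<in> G" "S \<subseteq> G"
  shows "Gcd S \<in> G"
proof (cases "S \<subseteq> {0}")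
  case True
  then have "Gcd S = 0" by (simp only: Gcd_0_iff)
  then show ?thesis using \<open>0 \<in> G\<close> by (simp only:)
next
  case False
  have neg: "- a \<in> G" if "a \<in> G" for a using diff[OF \<open>0 \<in> G\<close> that] by simp
  have add: "a + b \<in> G" if "a \<in> G" "b \<in> G" for a b using diff[OF that(1) neg[OF that(2)]] by simp
  have nmult: "int n * a \<in> G" if "a \<in> G" for a n
    by (induction n) (use that add assms in \<open>auto simp: algebra_simps\<close>)
  have mult: "k * a \<in> G" if "a \<in> G" for a k
    using nmult[OF that, of "nat k"] neg[OF nmult[OF that, of "nat (- k)"]] by (cases "0 \<le> k") auto
  from False obtain a where a: "a \<in> S" "a \<noteq> 0" by auto
  then have "\<bar>a\<bar> \<in> G" using assms neg by (auto simp: abs_if)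
  then have ex: "\<exists>n. 0 < n \<and> int n \<in> G" using a by (intro exI[of _ "nat \<bar>a\<bar>"]) auto
  define g where "g = (LEAST n. 0 < n \<and> int n \<in> G)"
  have g: "0 < g" "int g \<in> G" using LeastI_ex[OF ex] unfolding g_def by auto
  have least: "g \<le> n" if "0 < n" "int n \<in> G" for n
    unfolding g_def using that by (intro Least_le) auto
  have "int g dvd k" if "k \<in> G" for k
  proof (rule ccontr)
    assume "\<not> int g dvd k"
    then have nz: "k mod int g \<noteq> 0" by (simp add: dvd_eq_mod_eq_0)
    have r: "0 \<le> k mod int g" "k mod int g < int g" using g by auto
    have "k mod int g = k - (k div int g) * int g" by (simp add: minus_div_mult_eq_mod)
    then have "k mod int g \<in> G" using diff[OF that mult[OF g(2)]] by simp
    then have "g \<le> nat (k mod int g)" using r nz by (intro least) auto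
    then show False using r by linarith
  qed
  then have "int g dvd Gcd S" using assms by (intro Gcd_greatest) auto
  then obtain k where "Gcd S = int g * k" by (auto elim: dvdE)
  then show ?thesis using mult[OF g(2), of k] by (simp add: mult.commute)
qed

text \<open>The integers \<open>k\<close> for which \<open>k *s b\<close> lies in the image of
  \<open>A\<close> form a subgroup. Cramer's rule for the selected columns, with zeros in the other
  coordinates, puts every maximal minor into it; so it contains their gcd 1.\<close>

lemma surjective_of_Gcd_maximal_minors:
  fixes A :: "int ^ 'n ^ 'm" and b :: "int ^ 'm"
  assumes "Gcd (maximal_minors A) = 1"
  obtains z where "A *v z = b"
proof -
  let ?G = "{k. \<exists>z. A *v z = k *s b}"
  have "maximal_minors A \<subseteq> ?G"
  proof (clarsimp simp: maximal_minors_def)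
    fix f :: "'m \<Rightarrow> 'n" assume f: "inj f"
    let ?M = "\<chi> i j. A $ i $ f j"
    show "\<exists>z. A *v z = det ?M *s b"
    proof (cases "det ?M = 0")
      case True
      then show ?thesis by (intro exI[of _ 0]) (simp add: vec_eq_iff matrix_vector_mult_def)
    next
      case False
      define w :: "int ^ 'm" where "w = (\<chi> k. det (\<chi> i j. if j = k then b $ i else ?M $ i $ j))"
      define z :: "int ^ 'n" where "z = (\<chi> j. if j \<in> range f then w $ inv f j else 0)"
      have "A *v z = ?M *v (\<chi> j. z $ f j)"
        by (rule matrix_vector_mult_supported[OF f]) (simp add: z_def)
      also have "(\<chi> j. z $ f j) = w" using f by (simp add: z_def vec_eq_iff)
      also have "?M *v w = det ?M *s b" unfolding w_def by (rule cramer_of_int[OF False])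
      finally show ?thesis ..
    qed
  qed
  moreover have "0 \<in> ?G" by (auto intro!: exI[of _ 0] simp: vec_eq_iff matrix_vector_mult_def)
  moreover have "a - c \<in> ?G" if ac: "a \<in> ?G" "c \<in> ?G" for a c
  proof -
    from ac obtain y z where "A *v y = a *s b" "A *v z = c *s b" by auto
    then have "A *v (y - z) = (a - c) *s b"
      by (simp add: matrix_vector_mult_diff_distrib vec_eq_iff algebra_simps)
    then show ?thesis by auto
  qed
  ultimately have "Gcd (maximal_minors A) \<in> ?G" by (intro Gcd_int_mem_subgroup)
  then show ?thesis using assms that by auto
qed

lemma nonzero_minor_of_Gcd_maximal_minors:
  fixes A :: "int ^ 'n ^ 'm"
  assumes "Gcd (maximal_minors A) = 1"
  obtains f :: "'m \<Rightarrow> 'n" where "inj f" "det (\<chi> i j. A $ i $ f j) \<noteq> 0"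
proof -
  have "\<not> maximal_minors A \<subseteq> {0}"
  proof
    assume "maximal_minors A \<subseteq> {0}"
    then have "Gcd (maximal_minors A) = 0" by (simp only: Gcd_0_iff)
    with assms show False by simp
  qed
  then show ?thesis using that by (auto simp: maximal_minors_def)
qed

section \<open>Integer vectors inside the reals and rounding in the kernel\<close>

definition vec_of_int :: "int ^ 'k \<Rightarrow> real ^ 'k" where
  "vec_of_int z = (\<chi> i. real_of_int (z $ i))"

lemma vec_of_int_nth [simp]: "vec_of_int z $ i = real_of_int (z $ i)"
  by (simp add: vec_of_int_def)

lemma vec_of_int_simps [simp]:
  "vec_of_int 0 = 0" "vec_of_int (y + z) = vec_of_int y + vec_of_int z"
  "vec_of_int (y - z) = vec_of_int y - vec_of_int z"
  by (simp_all add: vec_eq_iff)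

lemma vec_of_int_inject [simp]: "vec_of_int y = vec_of_int z \<longleftrightarrow> y = z"
  by (simp add: vec_eq_iff)

lemma int_vecs_eq: "int_vecs = range vec_of_int"
proof -
  have "x \<in> range vec_of_int" if "\<forall>i. x $ i \<in> \<int>" for x :: "real ^ 'k"
    using that by (intro image_eqI[of _ _ "\<chi> i. \<lfloor>x $ i\<rfloor>"]) (auto simp: vec_eq_iff elim: Ints_cases)
  then show ?thesis by (auto simp: int_vecs_def)
qed

lemma real_matrix_mult_vec_of_int: "real_matrix A *v vec_of_int z = vec_of_int (A *v z)"
  by (simp add: vec_eq_iff matrix_vector_mult_def map_matrix_def)

text \<open>In a kernel vector the entries outside a nonsingular choice of columns determine the
  others. This uniqueness justifies the coordinates used for rounding.\<close>

lemma kernel_eq_zero_of_minor: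
  fixes A :: "int ^ 'n ^ 'm" and y :: "real ^ 'n" and f :: "'m \<Rightarrow> 'n"
  assumes "inj f" "det (\<chi> i j. A $ i $ f j) \<noteq> 0" "real_matrix A *v y = 0"
    and "\<And>j. j \<notin> range f \<Longrightarrow> y $ j = 0"
  shows "y = 0"
proof -
  let ?M = "\<chi> i j. A $ i $ f j"
  have "(\<chi> i j. real_matrix A $ i $ f j) = real_matrix ?M"
    by (simp add: vec_eq_iff map_matrix_def)
  then have "real_matrix ?M *v (\<chi> j. y $ f j) = 0"
    using matrix_vector_mult_supported[OF assms(1), of y "real_matrix A"] assms by simp
  moreover have "invertible (real_matrix ?M)"
    using assms(2) by (simp add: invertible_det_nz det_map_matrix_of_int)
  ultimately have "(\<chi> j. y $ f j) = 0"
    by (metis (no_types) invertible_def matrix_left_invertible_ker)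
  then have "y $ f j = 0" for j by (simp add: vec_eq_iff)
  then show ?thesis using assms(4) by (metis rangeE vec_eq_iff zero_index)
qed

text \<open>
  The circuits of \<open>A\<close> through a basis \<open>f\<close>, given by Cramer's rule, have maximal minors as
  entries and span the kernel; rounding the coefficients of \<open>y\<close> with respect to them gives \<open>l\<close>.
\<close>

lemma kernel_lattice_rounding:
  fixes A :: "int ^ 'n ^ 'm" and y :: "real ^ 'n" and f :: "'m \<Rightarrow> 'n"
  assumes f: "inj f" and nz: "det (\<chi> i j. A $ i $ f j) \<noteq> 0"
    and D: "\<And>g :: 'm \<Rightarrow> 'n. inj g \<Longrightarrow> \<bar>real_of_int (det (\<chi> i j. A $ i $ g j))\<bar> \<le> D"
    and y: "real_matrix A *v y = 0"
  obtains l where "A *v l = 0"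
    "\<forall>k. \<bar>y $ k - real_of_int (l $ k)\<bar> \<le> (real CARD('n) - real CARD('m)) / 2 * D"
proof -
  define M where "M = (\<chi> i j. A $ i $ f j)"
  define \<delta> where "\<delta> = det M"
  have \<delta>: "\<delta> \<noteq> 0" using nz by (simp add: \<delta>_def M_def)
  define J where "J = - range f"
  have cJ: "real (card J) = real CARD('n) - real CARD('m)"
  proof -
    have "card (range f) = CARD('m)" using f by (simp add: card_image)
    moreover have "card (range f) \<le> CARD('n)" by (rule card_mono) auto
    ultimately show ?thesis unfolding J_def Compl_eq_Diff_UNIV by (subst card_Diff_subset) auto
  qed
  define w :: "'n \<Rightarrow> int ^ 'm" where
    "w = (\<lambda>j. \<chi> k. det (\<chi> i j'. if j' = k then A $ i $ j else M $ i $ j'))"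
  \<comment> \<open>For \<open>j\<close> in \<open>J\<close> this is the linear relation between
    column \<open>j\<close> and the basis columns: \<delta> at \<open>j\<close>, zero elsewhere in
    \<open>J\<close>, and the negated Cramer numerators on the range of \<open>f\<close>.\<close>
  define h :: "'n \<Rightarrow> int ^ 'n" where
    "h = (\<lambda>j. \<chi> k. if k \<in> range f then - w j $ inv f k else if k = j then \<delta> else 0)"
  have hJ: "h j $ k = (if k = j then \<delta> else 0)" if "k \<in> J" for j k
    using that by (auto simp: h_def J_def)
  have kerh: "A *v h j = 0" if "j \<in> J" for j
  proof -
    define z where "z = h j - axis j \<delta>"
    have "z $ k = 0" if "k \<notin> range f" for k
      using that \<open>j \<in> J\<close> by (auto simp: z_def h_def axis_def)
    then have "A *v z = M *v (\<chi> j. z $ f j)"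
      unfolding M_def by (rule matrix_vector_mult_supported[OF f])
    also have "(\<chi> j. z $ f j) = - w j"
      using f \<open>j \<in> J\<close> by (auto simp: vec_eq_iff z_def h_def axis_def J_def)
    also have "M *v (- w j) = - (M *v w j)"
      by (simp add: vec_eq_iff matrix_vector_mult_def sum_negf)
    also have "M *v w j = \<delta> *s (\<chi> i. A $ i $ j)"
      using cramer_of_int[of M "\<chi> i. A $ i $ j"] \<delta> by (simp add: w_def \<delta>_def cong: if_cong)
    also have "- \<dots> = - (A *v axis j \<delta>)"
      by (simp add: vec_eq_iff matrix_vector_mult_def axis_def if_distrib if_distribR cong: if_cong)
    finally show ?thesis by (simp add: z_def matrix_vector_mult_diff_distrib)
  qed
  have D0: "\<bar>real_of_int \<delta>\<bar> \<le> D" using D[OF f] by (simp add: \<delta>_def M_def)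
  have hD: "\<bar>real_of_int (h j $ k)\<bar> \<le> D" if "j \<in> J" for j k
  proof (cases "k \<in> range f")
    case True
    then obtain i where k: "k = f i" by auto
    \<comment> \<open>The numerator at \<open>f i\<close> is the determinant in which column
      \<open>f i\<close> is exchanged for column \<open>j\<close>. It is again a maximal minor,
      since \<open>j\<close> lies outside the range of \<open>f\<close>.\<close>
    have "inj (f(i := j))"
      using f \<open>j \<in> J\<close> by (auto simp: inj_on_def J_def)
    from D[OF this] have "\<bar>real_of_int (det (\<chi> i' j'. A $ i' $ (f(i := j)) j'))\<bar> \<le> D" .
    moreover have "(\<chi> i' j'. A $ i' $ (f(i := j)) j') = (\<chi> i' j'. if j' = i then A $ i' $ j else M $ i' $ j')"
      by (simp add: vec_eq_iff M_def)
    ultimately show ?thesis using f by (simp add: h_def k w_def)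
  qed (use D0 in \<open>auto simp: h_def\<close>)
  \<comment> \<open>On \<open>J\<close> the vectors \<open>h j\<close> are \<delta> times unit
    vectors, so these are the only possible coefficients of \<open>y\<close>.\<close>
  define c where "c j = y $ j / real_of_int \<delta>" for j
  define l where "l = (\<Sum>j\<in>J. round (c j) *s h j)"
  have lin: "real_matrix A *v (\<Sum>j\<in>J. a j *\<^sub>R vec_of_int (h j)) = 0" for a
    using kerh by (simp add: linear_sum[OF matrix_vector_mul_linear] matrix_vector_mult_scaleR
        real_matrix_mult_vec_of_int)
  have yrep: "y = (\<Sum>j\<in>J. c j *\<^sub>R vec_of_int (h j))"
  proof -
    have "y - (\<Sum>j\<in>J. c j *\<^sub>R vec_of_int (h j)) = 0"
    proof (rule kernel_eq_zero_of_minor[OF f nz])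
      show "real_matrix A *v (y - (\<Sum>j\<in>J. c j *\<^sub>R vec_of_int (h j))) = 0"
        using lin y by (simp add: matrix_vector_mult_diff_distrib)
      fix k assume "k \<notin> range f"
      then have "k \<in> J" by (simp add: J_def)
      then show "(y - (\<Sum>j\<in>J. c j *\<^sub>R vec_of_int (h j))) $ k = 0"
        using \<delta> by (simp add: hJ c_def if_distrib cong: if_cong)
    qed
    then show ?thesis by simp
  qed
  show ?thesis
  proof (rule that, safe)
    show "A *v l = 0"
    proof -
      have "vec_of_int l = (\<Sum>j\<in>J. of_int (round (c j)) *\<^sub>R vec_of_int (h j))"
        by (simp add: vec_eq_iff l_def)
      then have "vec_of_int (A *v l) = vec_of_int 0"
        using lin by (simp flip: real_matrix_mult_vec_of_int)
      then show ?thesis by (simp only: vec_of_int_inject)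
    qed
    fix k
    have "y $ k - real_of_int (l $ k) = (\<Sum>j\<in>J. (c j - of_int (round (c j))) * real_of_int (h j $ k))"
      by (subst yrep) (simp add: l_def algebra_simps sum_subtractf)
    \<comment> \<open>Each of the n - m terms is a rounding error of at most 1/2 times an entry of
      at most \<open>D\<close>.\<close>
    also have "\<bar>\<dots>\<bar> \<le> (\<Sum>j\<in>J. 1 / 2 * D)"
    proof (rule order_trans[OF sum_abs sum_mono])
      fix j assume "j \<in> J"
      have "\<bar>c j - of_int (round (c j))\<bar> \<le> 1 / 2"
        using of_int_round_abs_le[of "c j"] by (simp add: abs_minus_commute)
      then show "\<bar>(c j - of_int (round (c j))) * real_of_int (h j $ k)\<bar> \<le> 1 / 2 * D"
        unfolding abs_mult using hD[OF \<open>j \<in> J\<close>] by (intro mult_mono) auto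
    qed
    finally show "\<bar>y $ k - real_of_int (l $ k)\<bar> \<le> (real CARD('n) - real CARD('m)) / 2 * D"
      by (simp add: cJ)
  qed
qed

section \<open>The Prekopa-Leindler inequality\<close>

lemma emeasure_lborel_inner_regular:
  fixes A :: "real set"
  assumes A: "A \<in> sets borel"
  shows "emeasure lborel A = (SUP K\<in>{K. K \<subseteq> A \<and> compact K}. emeasure lborel K)"
proof (rule antisym)
  let ?S = "SUP K\<in>{K. K \<subseteq> A \<and> compact K}. emeasure lborel K"
  let ?J = "\<lambda>n::nat. {- real n..real n}"
  have trunc: "emeasure lborel (A \<inter> ?J n) \<le> ?S" for n
  proof -
    \<comment> \<open>Inner regularity is applied to a finite measure, so Lebesgue measure is first
      cut down to a bounded interval.\<close>
    let ?M = "density lborel (indicator (?J n))"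
    have M: "emeasure ?M X = emeasure lborel (X \<inter> ?J n)" if "X \<in> sets borel" for X
      using that by (simp add: emeasure_density nn_integral_indicator indicator_inter_arith[symmetric] Int_commute)
    have "emeasure ?M A = (SUP K\<in>{K. K \<subseteq> A \<and> compact K}. emeasure ?M K)"
      by (rule inner_regular) (use A M in auto)
    also have "\<dots> \<le> ?S"
    proof (rule SUP_least)
      fix K assume K: "K \<in> {K. K \<subseteq> A \<and> compact K}"
      then have "emeasure ?M K = emeasure lborel (K \<inter> ?J n)"
        by (intro M) (auto intro: borel_compact)
      also have "\<dots> \<le> emeasure lborel K" using K by (intro emeasure_mono) (auto intro: borel_compact)
      also have "\<dots> \<le> ?S" by (rule SUP_upper[OF K])
      finally show "emeasure ?M K \<le> ?S" .
    qed
    finally show ?thesis using M[OF A] by simp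
  qed
  have "emeasure lborel A = emeasure lborel (\<Union>n. A \<inter> ?J n)"
  proof -
    have "x \<in> (\<Union>n. A \<inter> ?J n)" if "x \<in> A" for x
    proof -
      obtain n :: nat where "\<bar>x\<bar> \<le> real n" using real_arch_simple by blast
      then show ?thesis using that by (auto simp: abs_le_iff intro!: exI[of _ n])
    qed
    then have "A = (\<Union>n. A \<inter> ?J n)" by auto
    then show ?thesis by simp
  qed
  also have "\<dots> = (SUP n. emeasure lborel (A \<inter> ?J n))"
    by (rule SUP_emeasure_incseq[symmetric]) (use A in \<open>auto simp: incseq_def\<close>)
  also have "\<dots> \<le> ?S" by (rule SUP_least) (rule trunc)
  finally show "emeasure lborel A \<le> ?S" .
qed (use A in \<open>auto intro!: SUP_least emeasure_mono\<close>)

text \<open>Shift \<open>K\<close> by the least element \<open>b\<close> of \<open>L\<close>, and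
  \<open>L\<close> by the greatest element \<open>a\<close> of \<open>K\<close>. Both copies lie in
  \<open>S\<close> and share only the point \<open>a + b\<close>, so their measures add up.\<close>

lemma emeasure_sumset_compact_ge:
  fixes K L S :: "real set"
  assumes "compact K" "compact L" "K \<noteq> {}" "L \<noteq> {}" "S \<in> sets borel"
    and S: "\<And>x y. x \<in> K \<Longrightarrow> y \<in> L \<Longrightarrow> x + y \<in> S"
  shows "emeasure lborel K + emeasure lborel L \<le> emeasure lborel S"
proof -
  obtain a where a: "a \<in> K" "\<And>x. x \<in> K \<Longrightarrow> x \<le> a"
    using compact_attains_sup[OF assms(1,3)] by auto
  obtain b where b: "b \<in> L" "\<And>x. x \<in> L \<Longrightarrow> b \<le> x"
    using compact_attains_inf[OF assms(2,4)] by auto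
  have trans: "emeasure lborel ((+) c ` X) = emeasure lborel X" if "compact X" for c :: real and X
  proof -
    have "X \<in> sets borel" "(+) c ` X \<in> sets borel"
      using that compact_translation[OF that, of c] by (auto intro: borel_compact)
    then have "emeasure (distr lborel borel ((+) c)) ((+) c ` X) = emeasure lborel X"
      by (subst emeasure_distr) (auto simp: inj_vimage_image_eq)
    then show ?thesis by (simp add: lborel_distr_plus)
  qed
  let ?X = "(+) b ` K" and ?Y = "(+) a ` L"
  have cX: "compact ?X" and cY: "compact ?Y"
    using assms compact_translation by blast+
  then have m: "?X \<in> sets lborel" "?Y - {a + b} \<in> sets lborel" "?Y \<in> sets lborel"
    by (auto intro: borel_compact)
  have "emeasure lborel K + emeasure lborel L = emeasure lborel ?X + emeasure lborel ?Y"
    using trans assms by simp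
  also have "emeasure lborel ?Y = emeasure lborel (?Y - {a + b})"
    using m by (intro emeasure_Diff_null_set[symmetric]) (auto simp: null_sets_def)
  also have "emeasure lborel ?X + emeasure lborel (?Y - {a + b}) = emeasure lborel (?X \<union> (?Y - {a + b}))"
    using a b m by (intro plus_emeasure) (auto, force)
  also have "\<dots> \<le> emeasure lborel S"
    using S[OF a(1)] S[OF _ b(1)] assms(5) by (intro emeasure_mono) (auto simp: add.commute)
  finally show ?thesis .
qed

text \<open>Both sets are exhausted from inside by compact sets, which are scaled by
  \<open>1 - l\<close> and \<open>l\<close>. The compact sets are kept nonempty because the sumset
  inequality fails for an empty summand.\<close>

lemma emeasure_convex_combination_ge:
  fixes A B S :: "real set"
  assumes A: "A \<in> sets borel" "A \<noteq> {}" and B: "B \<in> sets borel" "B \<noteq> {}"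
    and S: "S \<in> sets borel" and l: "0 < l" "l < 1"
    and comb: "\<And>x y. x \<in> A \<Longrightarrow> y \<in> B \<Longrightarrow> (1 - l) * x + l * y \<in> S"
  shows "ennreal (1 - l) * emeasure lborel A + ennreal l * emeasure lborel B \<le> emeasure lborel S"
proof -
  let ?C = "\<lambda>A. {K. K \<subseteq> A \<and> compact K \<and> K \<noteq> ({} :: real set)}"
  have reg: "emeasure lborel X = (SUP K\<in>?C X. emeasure lborel K)"
    if "X \<in> sets borel" "X \<noteq> {}" for X :: "real set"
  proof (rule antisym)
    show "emeasure lborel X \<le> (SUP K\<in>?C X. emeasure lborel K)"
      unfolding emeasure_lborel_inner_regular[OF that(1)]
    proof (rule SUP_least)
      fix K assume K: "K \<in> {K. K \<subseteq> X \<and> compact K}"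
      show "emeasure lborel K \<le> (SUP K\<in>?C X. emeasure lborel K)"
        using K by (cases "K = {}") (auto intro: SUP_upper)
    qed
  qed (use that in \<open>auto intro!: SUP_least emeasure_mono\<close>)
  have ne: "?C X \<noteq> {}" if "X \<noteq> {}" for X :: "real set"
  proof -
    from that obtain x where "x \<in> X" by auto
    then have "{x} \<in> ?C X" by simp
    then show ?thesis by blast
  qed
  have scale: "emeasure lborel ((*) c ` K) = ennreal c * emeasure lborel K"
    if "compact K" "0 < c" for c :: real and K
  proof -
    have K: "K \<in> sets borel" "(*) c ` K \<in> sets borel"
      using that compact_scaling[OF that(1), of c] by (auto intro: borel_compact)
    have "emeasure lborel ((*) c ` K) = ennreal c * emeasure (distr lborel borel ((*) c)) ((*) c ` K)"
      using that K by (subst lborel_distr_mult'[of c]) (auto simp: emeasure_density nn_integral_cmult)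
    also have "emeasure (distr lborel borel ((*) c)) ((*) c ` K) = emeasure lborel K"
      using that K by (subst emeasure_distr) (auto simp: inj_vimage_image_eq inj_on_def)
    finally show ?thesis .
  qed
  have *: "ennreal (1 - l) * emeasure lborel K + ennreal l * emeasure lborel L \<le> emeasure lborel S"
    if "K \<in> ?C A" "L \<in> ?C B" for K L
  proof -
    have "emeasure lborel ((*) (1 - l) ` K) + emeasure lborel ((*) l ` L) \<le> emeasure lborel S"
      using that l compact_scaling[of K "1 - l"] compact_scaling[of L l] S comb
      by (intro emeasure_sumset_compact_ge) (auto simp: subset_eq)
    then show ?thesis using that l by (simp add: scale)
  qed
  show ?thesis
    unfolding reg[OF A] reg[OF B] SUP_mult_left_ennreal
    by (subst ennreal_SUP_add_left[symmetric, OF ne[OF A(2)]], intro SUP_least,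
        subst ennreal_SUP_add_right[OF ne[OF B(2)]], intro SUP_least *)
qed

section \<open>The Prekopa-Leindler inequality on the line\<close>

lemma nn_integral_layer_cake:
  fixes f :: "real \<Rightarrow> real"
  assumes [measurable]: "f \<in> borel_measurable borel" and f: "\<And>x. 0 \<le> f x"
  shows "(\<integral>\<^sup>+x. ennreal (f x) \<partial>lborel) =
    (\<integral>\<^sup>+t. indicator {0..} t * emeasure lborel {x. t < f x} \<partial>lborel)"
proof -
  have "(\<integral>\<^sup>+x. ennreal (f x) \<partial>lborel) =
      (\<integral>\<^sup>+x. (\<integral>\<^sup>+t. indicator {0..} t * (if t < f x then 1 else 0) \<partial>lborel) \<partial>lborel)"
  proof (rule nn_integral_cong)
    fix x :: real
    have "(\<integral>\<^sup>+t. indicator {0..} t * (if t < f x then 1 else 0 :: ennreal) \<partial>lborel) =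
        (\<integral>\<^sup>+t. indicator {0..<f x} t \<partial>lborel)"
      by (intro nn_integral_cong) (auto simp: indicator_def)
    then show "ennreal (f x) = (\<integral>\<^sup>+t. indicator {0..} t * (if t < f x then 1 else 0) \<partial>lborel)"
      using f[of x] by simp
  qed
  also have "\<dots> = (\<integral>\<^sup>+t. (\<integral>\<^sup>+x. indicator {0..} t * (if t < f x then 1 else 0) \<partial>lborel) \<partial>lborel)"
    by (rule lborel_pair.Fubini') measurable
  also have "\<dots> = (\<integral>\<^sup>+t. indicator {0..} t * emeasure lborel {x. t < f x} \<partial>lborel)"
  proof (rule nn_integral_cong)
    fix t :: real
    have "(\<integral>\<^sup>+x. indicator {0..} t * (if t < f x then 1 else 0 :: ennreal) \<partial>lborel) =
        indicator {0..} t * (\<integral>\<^sup>+x. indicator {x. t < f x} x \<partial>lborel)"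
      by (subst nn_integral_cmult[symmetric]) (auto intro!: nn_integral_cong simp: indicator_def)
    then show "(\<integral>\<^sup>+x. indicator {0..} t * (if t < f x then 1 else 0 :: ennreal) \<partial>lborel) =
        indicator {0..} t * emeasure lborel {x. t < f x}"
      by simp
  qed
  finally show ?thesis .
qed

text \<open>With both suprema equal to 1, the superlevel sets of \<open>f\<close> and
  \<open>g\<close> at a level in [0, 1) are nonempty, and convex combinations of their points lie in
  the superlevel set of \<open>m\<close>. The Brunn-Minkowski inequality is integrated over all
  levels, which even gives the arithmetic mean of the integrals.\<close>

lemma prekopa_leindler_normalized:
  fixes f g m :: "real \<Rightarrow> real"
  assumes [measurable]: "f \<in> borel_measurable borel" "g \<in> borel_measurable borel"
      "m \<in> borel_measurable borel"
    and f: "\<And>x. 0 \<le> f x" "\<And>x. f x \<le> 1" "\<And>t. t < 1 \<Longrightarrow> \<exists>x. t < f x"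
    and g: "\<And>x. 0 \<le> g x" "\<And>x. g x \<le> 1" "\<And>t. t < 1 \<Longrightarrow> \<exists>x. t < g x"
    and l: "0 < l" "l < 1"
    and m: "\<And>x y. f x powr (1 - l) * g y powr l \<le> m ((1 - l) * x + l * y)" "\<And>x. 0 \<le> m x"
  shows "ennreal (1 - l) * (\<integral>\<^sup>+x. f x \<partial>lborel) + ennreal l * (\<integral>\<^sup>+x. g x \<partial>lborel) \<le> (\<integral>\<^sup>+x. m x \<partial>lborel)"
proof -
  let ?c = "\<lambda>h t. indicator {0..} t * emeasure lborel {x. t < h x} :: ennreal"
  have [measurable]: "(\<lambda>t. emeasure lborel {x. t < h x}) \<in> borel_measurable borel"
    if [measurable]: "h \<in> borel_measurable borel" for h :: "real \<Rightarrow> real"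
  proof -
    have "(\<lambda>t. \<integral>\<^sup>+x. (if t < h x then 1 else 0 :: ennreal) \<partial>lborel) \<in> borel_measurable borel"
      by measurable
    moreover have "(\<integral>\<^sup>+x. (if t < h x then 1 else 0 :: ennreal) \<partial>lborel) = emeasure lborel {x. t < h x}" for t
    proof -
      have "(\<integral>\<^sup>+x. (if t < h x then 1 else 0 :: ennreal) \<partial>lborel) =
          (\<integral>\<^sup>+x. indicator {x. t < h x} x \<partial>lborel)"
        by (intro nn_integral_cong) (simp add: indicator_def)
      then show ?thesis by simp
    qed
    ultimately show ?thesis by simp
  qed
  have le: "ennreal (1 - l) * ?c f t + ennreal l * ?c g t \<le> ?c m t" for t
  proof (cases "0 \<le> t \<and> t < 1")
    case True
    have "ennreal (1 - l) * emeasure lborel {x. t < f x} + ennreal l * emeasure lborel {x. t < g x}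
        \<le> emeasure lborel {x. t < m x}"
    proof (rule emeasure_convex_combination_ge[OF _ _ _ _ _ l])
      fix x y assume xy: "x \<in> {x. t < f x}" "y \<in> {x. t < g x}"
      have "t = t powr (1 - l) * t powr l" using True by (simp flip: powr_add)
      also have "\<dots> < f x powr (1 - l) * g y powr l"
        using xy True l by (intro mult_strict_mono powr_less_mono2) auto
      also have "\<dots> \<le> m ((1 - l) * x + l * y)" by (rule m)
      finally show "(1 - l) * x + l * y \<in> {x. t < m x}" by simp
    qed (use f(3) g(3) True in auto)
    then show ?thesis using True by simp
  next
    case False
    then consider "t < 0" | "1 \<le> t" by linarith
    then show ?thesis
    proof cases
      assume "1 \<le> t"
      then have "{x. t < f x} = {}" "{x. t < g x} = {}"
        using f(2) g(2) by (auto simp: not_less intro: order_trans)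
      then show ?thesis by simp
    qed simp
  qed
  have "ennreal (1 - l) * (\<integral>\<^sup>+x. f x \<partial>lborel) + ennreal l * (\<integral>\<^sup>+x. g x \<partial>lborel) =
      (\<integral>\<^sup>+t. ennreal (1 - l) * ?c f t + ennreal l * ?c g t \<partial>lborel)"
    using f g by (simp add: nn_integral_layer_cake nn_integral_add nn_integral_cmult)
  also have "\<dots> \<le> (\<integral>\<^sup>+t. ?c m t \<partial>lborel)" by (rule nn_integral_mono) (rule le)
  also have "\<dots> = (\<integral>\<^sup>+x. m x \<partial>lborel)" using m by (simp add: nn_integral_layer_cake)
  finally show ?thesis .
qed

text \<open>Dividing by the suprema \<open>a\<close> and \<open>b\<close>, and \<open>m\<close> by
  \<open>c\<close>, reduces to the normalized case. The weighted inequality of arithmetic and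
  geometric means then gives the multiplicative form, from which the scalings cancel.\<close>

lemma prekopa_leindler_real:
  fixes f g m :: "real \<Rightarrow> real"
  assumes int: "integrable lborel f" "integrable lborel g" "integrable lborel m"
    and f: "\<And>x. 0 \<le> f x" "\<And>x. f x \<le> C" and g: "\<And>x. 0 \<le> g x" "\<And>x. g x \<le> C"
    and l: "0 < l" "l < 1"
    and m: "\<And>x y. f x powr (1 - l) * g y powr l \<le> m ((1 - l) * x + l * y)" "\<And>x. 0 \<le> m x"
  shows "(\<integral>x. f x \<partial>lborel) powr (1 - l) * (\<integral>x. g x \<partial>lborel) powr l \<le> (\<integral>x. m x \<partial>lborel)"
proof (cases "(\<integral>x. f x \<partial>lborel) = 0 \<or> (\<integral>x. g x \<partial>lborel) = 0")
  case True
  \<comment> \<open>\<open>0 powr x\<close> is 0 for every \<open>x\<close>, so the left side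
    vanishes.\<close>
  then show ?thesis using m(2) by (auto intro: integral_nonneg)
next
  case False
  let ?F = "\<integral>x. f x \<partial>lborel" and ?G = "\<integral>x. g x \<partial>lborel" and ?M = "\<integral>x. m x \<partial>lborel"
  have F: "?F > 0" and G: "?G > 0"
    using False f(1) g(1) by (auto simp: less_le intro!: integral_nonneg)
  have [measurable]: "f \<in> borel_measurable borel" "g \<in> borel_measurable borel" "m \<in> borel_measurable borel"
    using int by auto
  define a b where "a = Sup (range f)" and "b = Sup (range g)"
  have bdd: "bdd_above (range f)" "bdd_above (range g)" using f(2) g(2) unfolding bdd_above_def by blast+
  have fa: "f x \<le> a" for x unfolding a_def using bdd by (intro cSup_upper) auto
  have gb: "g x \<le> b" for x unfolding b_def using bdd by (intro cSup_upper) auto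
  have a: "a > 0"
  proof (rule ccontr)
    assume "\<not> a > 0"
    then have "f = (\<lambda>_. 0)" using fa f(1) by (intro ext antisym) (auto intro: order_trans[OF fa])
    with F show False by simp
  qed
  have b: "b > 0"
  proof (rule ccontr)
    assume "\<not> b > 0"
    then have "g = (\<lambda>_. 0)" using gb g(1) by (intro ext antisym) (auto intro: order_trans[OF gb])
    with G show False by simp
  qed
  define c where "c = a powr (1 - l) * b powr l"
  have c: "c > 0" using a b by (simp add: c_def)
  have "ennreal (1 - l) * (\<integral>\<^sup>+x. f x / a \<partial>lborel) + ennreal l * (\<integral>\<^sup>+x. g x / b \<partial>lborel)
      \<le> (\<integral>\<^sup>+x. m x / c \<partial>lborel)"
  proof (rule prekopa_leindler_normalized[OF _ _ _ _ _ _ _ _ _ l])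
    fix t :: real assume "t < 1"
    then have "t * a < a" "t * b < b" using a b by auto
    then show "\<exists>x. t < f x / a" "\<exists>x. t < g x / b"
      using less_cSup_iff[OF _ bdd(1), of "t * a"] less_cSup_iff[OF _ bdd(2), of "t * b"] a b
      by (auto simp: a_def[symmetric] b_def[symmetric] pos_less_divide_eq)
  next
    fix x y
    have "(f x / a) powr (1 - l) * (g y / b) powr l = f x powr (1 - l) * g y powr l / c"
      using f(1) g(1) a b by (simp add: powr_divide c_def)
    also have "\<dots> \<le> m ((1 - l) * x + l * y) / c" using m(1) c by (intro divide_right_mono) auto
    finally show "(f x / a) powr (1 - l) * (g y / b) powr l \<le> m ((1 - l) * x + l * y) / c" .
  qed (use f g m fa gb a b c in auto)
  moreover have nn: "(\<integral>\<^sup>+x. h x / d \<partial>lborel) = ennreal ((\<integral>x. h x \<partial>lborel) / d)"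
    if "integrable lborel h" "\<And>x. 0 \<le> h x" "d > 0" for h :: "real \<Rightarrow> real" and d
    using that by (subst nn_integral_eq_integral) auto
  moreover have "ennreal ((1 - l) * (?F / a) + l * (?G / b)) =
      ennreal (1 - l) * ennreal (?F / a) + ennreal l * ennreal (?G / b)"
    using a b l F G by (subst ennreal_plus) (auto simp: ennreal_mult'[symmetric])
  ultimately have "ennreal ((1 - l) * (?F / a) + l * (?G / b)) \<le> ennreal (?M / c)"
    using int f g m a b c by (simp add: nn)
  moreover have "0 \<le> ?M / c" using m c by (auto intro!: divide_nonneg_pos integral_nonneg)
  ultimately have *: "(1 - l) * (?F / a) + l * (?G / b) \<le> ?M / c" by (simp add: ennreal_le_iff)
  have "?F powr (1 - l) * ?G powr l / c = (?F / a) powr (1 - l) * (?G / b) powr l"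
    using F G a b by (simp add: powr_divide c_def)
  also have "\<dots> \<le> (1 - l) * (?F / a) + l * (?G / b)"
    using F G a b l by (intro Youngs_inequality_0) auto
  finally have "?F powr (1 - l) * ?G powr l / c \<le> ?M / c" using * by linarith
  then show ?thesis using c by (simp add: divide_le_cancel)
qed

text \<open>Test functions take values in [0, 1], so that they are integrable for every probability
  measure and their section integrals are again test functions in the induction over
  coordinates.\<close>

definition prekopa_leindler :: "real \<Rightarrow> real measure \<Rightarrow> bool" where
  "prekopa_leindler l M \<longleftrightarrow> (\<forall>f g m.
     f \<in> borel_measurable borel \<and> g \<in> borel_measurable borel \<and> m \<in> borel_measurable borel \<and>
     (\<forall>x. f x \<in> {0..1} \<and> g x \<in> {0..1} \<and> m x \<in> {0..1}) \<and>
     (\<forall>x y. f x powr (1 - l) * g y powr l \<le> m ((1 - l) * x + l * y)) \<longrightarrow>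
     integral\<^sup>L M f powr (1 - l) * integral\<^sup>L M g powr l \<le> integral\<^sup>L M m)"

text \<open>A log-concave density is absorbed into the functions: \<open>w * f\<close>,
  \<open>w * g\<close> and \<open>w * m\<close> satisfy the hypothesis of the inequality for
  Lebesgue measure.\<close>

lemma prekopa_leindler_density:
  fixes w :: "real \<Rightarrow> real"
  assumes w: "integrable lborel w" "\<And>x. 0 \<le> w x" "\<And>x. w x \<le> 1"
    and l: "0 < l" "l < 1"
    and lc: "\<And>x y. w x powr (1 - l) * w y powr l \<le> w ((1 - l) * x + l * y)"
  shows "prekopa_leindler l (density lborel (\<lambda>x. ennreal (w x)))"
  unfolding prekopa_leindler_def
proof (intro allI impI, elim conjE)
  fix f g m :: "real \<Rightarrow> real"
  assume meas [measurable]: "f \<in> borel_measurable borel" "g \<in> borel_measurable borel" "m \<in> borel_measurable borel"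
    and rng: "\<forall>x. f x \<in> {0..1} \<and> g x \<in> {0..1} \<and> m x \<in> {0..1}"
    and le: "\<forall>x y. f x powr (1 - l) * g y powr l \<le> m ((1 - l) * x + l * y)"
  have [measurable]: "w \<in> borel_measurable borel" using w by auto
  let ?D = "density lborel (\<lambda>x. ennreal (w x))"
  have int: "integrable lborel (\<lambda>x. w x * h x)"
    if "\<And>x. h x \<in> {0..1}" "h \<in> borel_measurable borel" for h :: "real \<Rightarrow> real"
    by (rule Bochner_Integration.integrable_bound[OF w(1)])
       (use that w in \<open>auto intro!: AE_I2 mult_left_le simp: abs_mult\<close>)
  have eq: "integral\<^sup>L ?D h = (\<integral>x. w x * h x \<partial>lborel)"
    if "h \<in> borel_measurable borel" for h :: "real \<Rightarrow> real"
    using that w by (subst integral_density) auto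
  have "(\<integral>x. w x * f x \<partial>lborel) powr (1 - l) * (\<integral>x. w x * g x \<partial>lborel) powr l \<le> (\<integral>x. w x * m x \<partial>lborel)"
  proof (rule prekopa_leindler_real[where C = 1, OF int int int _ _ _ _ l])
    fix x y
    have "(w x * f x) powr (1 - l) * (w y * g y) powr l =
        (w x powr (1 - l) * w y powr l) * (f x powr (1 - l) * g y powr l)"
      using w rng by (simp add: powr_mult)
    also have "\<dots> \<le> w ((1 - l) * x + l * y) * m ((1 - l) * x + l * y)"
      using lc le w by (intro mult_mono) auto
    finally show "(w x * f x) powr (1 - l) * (w y * g y) powr l \<le>
        w ((1 - l) * x + l * y) * m ((1 - l) * x + l * y)" .
  qed (use rng meas w in \<open>auto intro!: mult_le_one\<close>)
  then show "integral\<^sup>L ?D f powr (1 - l) * integral\<^sup>L ?D g powr l \<le> integral\<^sup>L ?D m"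
    by (simp add: eq meas)
qed

lemma (in prob_space) integral_unit_interval:
  fixes f :: "'a \<Rightarrow> real"
  assumes "\<And>x. f x \<in> {0..1}"
  shows "integral\<^sup>L M f \<in> {0..1}"
proof (cases "integrable M f")
  case True
  then show ?thesis using assms by (auto intro!: integral_nonneg integral_le_const)
qed (simp add: not_integrable_integral_eq)

text \<open>Tensorization: the inequality for \<open>M k\<close> says that the integrals over
  coordinate \<open>k\<close> satisfy the hypothesis in the remaining coordinates, to which the
  induction hypothesis applies; Fubini puts the two together.\<close>

lemma prekopa_leindler_PiM:
  fixes M :: "'i \<Rightarrow> real measure" and f g m :: "('i \<Rightarrow> real) \<Rightarrow> real"
  assumes fin: "finite I" and prob: "\<And>i. prob_space (M i)" and sets: "\<And>i. sets (M i) = sets borel"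
    and PL: "\<And>i. prekopa_leindler l (M i)"
    and meas: "f \<in> borel_measurable (Pi\<^sub>M I M)" "g \<in> borel_measurable (Pi\<^sub>M I M)" "m \<in> borel_measurable (Pi\<^sub>M I M)"
    and rng: "\<And>x. f x \<in> {0..1}" "\<And>x. g x \<in> {0..1}" "\<And>x. m x \<in> {0..1}"
    and le: "\<And>x y. x \<in> extensional I \<Longrightarrow> y \<in> extensional I \<Longrightarrow>
      f x powr (1 - l) * g y powr l \<le> m (\<lambda>i\<in>I. (1 - l) * x i + l * y i)"
  shows "integral\<^sup>L (Pi\<^sub>M I M) f powr (1 - l) * integral\<^sup>L (Pi\<^sub>M I M) g powr l \<le> integral\<^sup>L (Pi\<^sub>M I M) m"
  using fin meas rng le
proof (induction I arbitrary: f g m rule: finite_induct)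
  \<comment> \<open>The product over no coordinates is the point mass at the everywhere undefined
    function.\<close>
  case empty
  have "integral\<^sup>L (Pi\<^sub>M {} M) h = h (\<lambda>_. undefined)" for h :: "('i \<Rightarrow> real) \<Rightarrow> real"
    by (simp add: PiM_empty lebesgue_integral_count_space_finite)
  then show ?case using empty.prems(7)[of "\<lambda>_. undefined" "\<lambda>_. undefined"]
    by (simp add: restrict_def)
next
  case (insert k I f g m)
  interpret product_sigma_finite M
    by (rule product_sigma_finite.intro) (rule prob_space_imp_sigma_finite[OF prob])
  interpret K: prob_space "M k" by (rule prob)
  interpret P: prob_space "Pi\<^sub>M (insert k I) M" by (rule prob_space_PiM) (rule prob)
  note meas = insert.prems(1-3) and rng = insert.prems(4-6) and le = insert.prems(7)
  have int: "integrable (Pi\<^sub>M (insert k I) M) h"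
    if "h \<in> borel_measurable (Pi\<^sub>M (insert k I) M)" "\<And>x. h x \<in> {0..1}" for h :: "_ \<Rightarrow> real"
    by (rule P.integrable_const_bound[of _ 1]) (use that in auto)
  have eq: "integral\<^sup>L (Pi\<^sub>M (insert k I) M) h = (\<integral>x. (\<integral>s. h (x(k := s)) \<partial>M k) \<partial>Pi\<^sub>M I M)"
    if "h \<in> borel_measurable (Pi\<^sub>M (insert k I) M)" "\<And>x. h x \<in> {0..1}" for h :: "_ \<Rightarrow> real"
    using insert.hyps by (intro product_integral_insert int that) auto
  have mI: "(\<lambda>x. \<integral>s. h (x(k := s)) \<partial>M k) \<in> borel_measurable (Pi\<^sub>M I M)"
    if [measurable]: "h \<in> borel_measurable (Pi\<^sub>M (insert k I) M)" for h :: "_ \<Rightarrow> real"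
    by measurable
  have sec: "(\<lambda>s. h (x(k := s))) \<in> borel_measurable borel"
    if "h \<in> borel_measurable (Pi\<^sub>M (insert k I) M)" "x \<in> extensional I" for h :: "_ \<Rightarrow> real" and x
  proof -
    have "x \<in> space (Pi\<^sub>M I M)" using that(2) sets_eq_imp_space_eq[OF sets] by (simp add: space_PiM PiE_def)
    then have "(\<lambda>s. x(k := s)) \<in> measurable (M k) (Pi\<^sub>M (insert k I) M)"
      using insert.hyps by (intro measurable_component_update)
    from measurable_compose[OF this that(1)] show ?thesis
      by (simp add: measurable_cong_sets[OF sets refl])
  qed
  show ?case
    unfolding eq[OF meas(1) rng(1)] eq[OF meas(2) rng(2)] eq[OF meas(3) rng(3)]
  proof (rule insert.IH[OF mI[OF meas(1)] mI[OF meas(2)] mI[OF meas(3)]])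
    fix x y :: "'i \<Rightarrow> real" assume x: "x \<in> extensional I" and y: "y \<in> extensional I"
    let ?z = "\<lambda>i\<in>I. (1 - l) * x i + l * y i"
    have comb: "f (x(k := s)) powr (1 - l) * g (y(k := t)) powr l \<le> m (?z(k := (1 - l) * s + l * t))" for s t
    proof -
      have "x(k := s) \<in> extensional (insert k I)" "y(k := t) \<in> extensional (insert k I)"
        using x y by (auto simp: extensional_def)
      note le[OF this]
      moreover have "(\<lambda>i\<in>insert k I. (1 - l) * (x(k := s)) i + l * (y(k := t)) i) = ?z(k := (1 - l) * s + l * t)"
        using insert.hyps by (auto simp: fun_eq_iff restrict_def)
      ultimately show ?thesis by (simp only:)
    qed
    have z: "?z \<in> extensional I" by simp
    show "(\<integral>s. f (x(k := s)) \<partial>M k) powr (1 - l) * (\<integral>s. g (y(k := s)) \<partial>M k) powr l \<le>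
        (\<integral>s. m (?z(k := s)) \<partial>M k)"
      by (rule PL[of k, unfolded prekopa_leindler_def, rule_format])
         (intro conjI allI sec[OF meas(1) x] sec[OF meas(2) y] sec[OF meas(3) z] rng comb)
  qed (rule K.integral_unit_interval, rule rng)+
qed

section \<open>The uniform and the Gaussian law on the line\<close>

definition unit_uniform :: "real measure" where
  "unit_uniform = density lborel (\<lambda>x. ennreal (indicator {-1/2..1/2} x))"

text \<open>The factor \<open>pi\<close> makes both the total mass and the maximum of the density
  equal to 1, as for \<open>unit_uniform\<close>. Hence the uniform density is the larger one on its
  interval.\<close>

definition unit_gaussian :: "real measure" where
  "unit_gaussian = density lborel (\<lambda>x. ennreal (exp (- (pi * x\<^sup>2))))"

lemma exp_pi_eq_normal_density: "exp (- (pi * x\<^sup>2)) = normal_density 0 (1 / sqrt (2 * pi)) x"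
  by (simp add: normal_density_def power_divide real_sqrt_divide)

lemma integral_gaussian_real:
  "integrable lborel (\<lambda>x::real. exp (- (pi * x\<^sup>2)))" "(\<integral>x. exp (- (pi * x\<^sup>2)) \<partial>lborel) = 1"
  "(\<integral>\<^sup>+x. ennreal (exp (- (pi * (x::real)\<^sup>2))) \<partial>lborel) = 1"
proof -
  show i: "integrable lborel (\<lambda>x::real. exp (- (pi * x\<^sup>2)))"
    unfolding exp_pi_eq_normal_density by (rule integrable_normal_density) simp
  show s: "(\<integral>x. exp (- (pi * x\<^sup>2)) \<partial>lborel) = 1"
    unfolding exp_pi_eq_normal_density by (rule integral_normal_density) simp
  show "(\<integral>\<^sup>+x. ennreal (exp (- (pi * (x::real)\<^sup>2))) \<partial>lborel) = 1"
    by (subst nn_integral_eq_integral[OF i]) (simp_all only: s, auto)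
qed

lemma integral_unit_indicator:
  "integrable lborel (indicator {-1/2..1/2} :: real \<Rightarrow> real)"
  "(\<integral>x. indicator {-1/2..1/2::real} x \<partial>lborel) = (1::real)"
  by auto

lemma unit_measures [simp]:
  "prob_space unit_uniform" "prob_space unit_gaussian"
  "sets unit_uniform = sets borel" "sets unit_gaussian = sets borel"
  unfolding unit_uniform_def unit_gaussian_def
  by (auto intro!: prob_spaceI simp: emeasure_density integral_gaussian_real ennreal_indicator)

lemma prekopa_leindler_unit_uniform:
  assumes "0 < l" "l < 1" shows "prekopa_leindler l unit_uniform"
  unfolding unit_uniform_def
proof (rule prekopa_leindler_density[OF integral_unit_indicator(1) _ _ assms])
  fix x y :: real
  have "(1 - l) * x + l * y \<in> {-1/2..1/2}" if "x \<in> {-1/2..1/2}" "y \<in> {-1/2..1/2}"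
    using convexD_alt[OF convex_real_interval(5) that, of l] assms by simp
  then show "indicator {-1/2..1/2} x powr (1 - l) * indicator {-1/2..1/2} y powr l \<le>
      (indicator {-1/2..1/2} ((1 - l) * x + l * y) :: real)"
    by (auto simp: indicator_def)
qed auto

lemma prekopa_leindler_unit_gaussian:
  assumes "0 < l" "l < 1" shows "prekopa_leindler l unit_gaussian"
  unfolding unit_gaussian_def
proof (rule prekopa_leindler_density[OF integral_gaussian_real(1) _ _ assms])
  fix x y :: real
  \<comment> \<open>The last term is the convexity defect of the square; its sign makes the Gaussian
    density log-concave.\<close>
  have "((1 - l) * x + l * y)\<^sup>2 = (1 - l) * x\<^sup>2 + l * y\<^sup>2 - l * (1 - l) * (x - y)\<^sup>2"
    by (simp add: power2_eq_square algebra_simps)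
  moreover have "0 \<le> l * (1 - l) * (x - y)\<^sup>2" using assms by simp
  ultimately have "pi * ((1 - l) * x + l * y)\<^sup>2 \<le> pi * ((1 - l) * x\<^sup>2 + l * y\<^sup>2)"
    by (intro mult_left_mono) auto
  then show "exp (- (pi * x\<^sup>2)) powr (1 - l) * exp (- (pi * y\<^sup>2)) powr l \<le> exp (- (pi * ((1 - l) * x + l * y)\<^sup>2))"
    by (simp add: powr_def mult_exp_exp algebra_simps)
qed auto

text \<open>The difference of the two densities and \<open>h - h (1/2)\<close> have the same sign.\<close>

lemma integral_unit_gaussian_le_unit_uniform:
  fixes h :: "real \<Rightarrow> real"
  assumes [measurable]: "h \<in> borel_measurable borel" and rng: "\<And>x. h x \<in> {0..1}"
    and mono: "\<And>s t. \<bar>s\<bar> \<le> \<bar>t\<bar> \<Longrightarrow> h t \<le> h s"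
  shows "integral\<^sup>L unit_gaussian h \<le> integral\<^sup>L unit_uniform h"
proof -
  let ?g = "\<lambda>x::real. exp (- (pi * x\<^sup>2))" and ?u = "indicator {-1/2..1/2} :: real \<Rightarrow> real"
  let ?c = "h (1/2)"
  have int: "integrable lborel (\<lambda>x. w x * h x)"
    if "integrable lborel w" "\<And>x. 0 \<le> w x" for w :: "real \<Rightarrow> real"
    by (rule Bochner_Integration.integrable_bound[OF that(1)])
       (use that rng in \<open>auto intro!: AE_I2 mult_left_le simp: abs_mult\<close>)
  have ig: "integrable lborel (\<lambda>x. ?g x * h x)" by (rule int) (auto intro: integral_gaussian_real)
  have iu: "integrable lborel (\<lambda>x. ?u x * h x)" by (rule int) (rule integral_unit_indicator, simp)
  have "0 \<le> (\<integral>x. (?u x - ?g x) * (h x - ?c) \<partial>lborel)"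
  proof (rule Bochner_Integration.integral_nonneg)
    fix x :: real
    show "0 \<le> (?u x - ?g x) * (h x - ?c)"
    proof (cases "\<bar>x\<bar> \<le> 1/2")
      case True
      then have "x \<in> {-1/2..1/2}" by (auto simp: abs_le_iff)
      then show ?thesis using mono[of x "1/2"] True by (intro mult_nonneg_nonneg) auto
    next
      case False
      then show ?thesis using mono[of "1/2" x] by (intro mult_nonpos_nonpos) (auto simp: indicator_def)
    qed
  qed
  also have "\<dots> = (\<integral>x. (?u x * h x - ?g x * h x) - ?c * (?u x - ?g x) \<partial>lborel)"
    by (simp add: algebra_simps)
  \<comment> \<open>The constant \<open>h (1/2)\<close> contributes nothing because both densities
    have total mass 1.\<close>
  also have "\<dots> = (\<integral>x. ?u x * h x \<partial>lborel) - (\<integral>x. ?g x * h x \<partial>lborel) - ?c * (1 - 1)"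
    using ig iu integral_gaussian_real integral_unit_indicator
    by (simp only: Bochner_Integration.integral_diff Bochner_Integration.integrable_diff
        integral_mult_right_zero integrable_mult_right)
  finally have "(\<integral>x. ?g x * h x \<partial>lborel) \<le> (\<integral>x. ?u x * h x \<partial>lborel)" by simp
  then show ?thesis
    unfolding unit_gaussian_def unit_uniform_def by (simp add: integral_density)
qed

lemma distr_unit_measures_uminus:
  "distr unit_uniform borel uminus = unit_uniform" "distr unit_gaussian borel uminus = unit_gaussian"
proof -
  have "distr (density lborel (\<lambda>x. ennreal (w x))) borel uminus = density lborel (\<lambda>x. ennreal (w x))"
    if [measurable]: "w \<in> borel_measurable borel" and even: "\<And>x. w (- x) = w x" for w :: "real \<Rightarrow> real"
  proof -
    have "density lborel (\<lambda>x. ennreal (w x)) = density (distr lborel borel uminus) (\<lambda>x. ennreal (w x))"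
      by (simp add: lborel_distr_uminus)
    also have "\<dots> = distr (density lborel (\<lambda>x. ennreal (w (- x)))) borel uminus"
      by (rule density_distr) auto
    finally show ?thesis by (simp add: even)
  qed
  note * = this
  show "distr unit_uniform borel uminus = unit_uniform"
    unfolding unit_uniform_def by (rule *) (auto simp: indicator_def)
  show "distr unit_gaussian borel uminus = unit_gaussian"
    unfolding unit_gaussian_def by (rule *) auto
qed

section \<open>Vaaler's inequality\<close>

text \<open>The setting for exchanging the law of the single coordinate \<open>k\<close>, while
  those in \<open>I\<close> keep theirs. Convexity and symmetry are phrased with restricted
  functions because the points of a product space are extensional.\<close>

locale convex_symmetric_section =
  fixes M :: "'i \<Rightarrow> real measure" and I :: "'i set" and k :: 'i and B :: "('i \<Rightarrow> real) set"
  assumes M: "\<And>i. M i = unit_uniform \<or> M i = unit_gaussian"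
    and fin: "finite I" and k: "k \<notin> I"
    and B: "B \<in> sets (Pi\<^sub>M (insert k I) (\<lambda>_. borel))"
    and conv: "\<And>x y l. x \<in> B \<Longrightarrow> y \<in> B \<Longrightarrow> 0 < l \<Longrightarrow> l < 1 \<Longrightarrow>
      (\<lambda>i\<in>insert k I. (1 - l) * x i + l * y i) \<in> B"
    and sym: "\<And>x. x \<in> B \<Longrightarrow> (\<lambda>i\<in>insert k I. - x i) \<in> B"
begin

lemma prob_M: "prob_space (M i)" and sets_M: "sets (M i) = sets borel"
  using M[of i] by auto

lemma sets_PiM_M: "sets (Pi\<^sub>M J M) = sets (Pi\<^sub>M J (\<lambda>_. borel))"
  by (rule sets_PiM_cong) (simp_all add: sets_M)

lemma space_PiM_M: "space (Pi\<^sub>M J M) = extensional J"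
  using sets_eq_imp_space_eq[OF sets_PiM_M] by (simp add: space_PiM PiE_def)

definition section_measure :: "real \<Rightarrow> real" where
  "section_measure s = measure (Pi\<^sub>M I M) {x \<in> space (Pi\<^sub>M I M). x(k := s) \<in> B}"

lemma measurable_update: "(\<lambda>x. x(k := s)) \<in> measurable (Pi\<^sub>M I M) (Pi\<^sub>M (insert k I) (\<lambda>_. borel))"
proof -
  have "(\<lambda>x. (x, s)) \<in> measurable (Pi\<^sub>M I M) (Pi\<^sub>M I (\<lambda>_. borel) \<Otimes>\<^sub>M borel)"
    by (intro measurable_Pair measurable_const) (auto intro: measurable_ident_sets[OF sets_PiM_M])
  from measurable_compose[OF this measurable_add_dim] show ?thesis by simp
qed

lemma section_sets: "{x \<in> space (Pi\<^sub>M I M). x(k := s) \<in> B} \<in> sets (Pi\<^sub>M I M)"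
  using measurable_sets[OF measurable_update B, of s] by (simp add: vimage_def Int_def conj_commute)

text \<open>Negating all coordinates preserves the product of even laws and, by the symmetry of
  \<open>B\<close>, exchanges the sections at \<open>s\<close> and \<open>- s\<close>.\<close>

lemma section_measure_uminus: "section_measure (- s) = section_measure s"
proof -
  have M1: "uminus \<in> measurable (M i) (M i)" for i
    by (simp add: measurable_cong_sets[OF sets_M sets_M])
  have meas: "compose I uminus \<in> measurable (Pi\<^sub>M I M) (Pi\<^sub>M I M)"
    unfolding compose_def
  proof (rule measurable_restrict)
    fix i assume "i \<in> I"
    from measurable_compose[OF measurable_component_singleton[OF this, of M] M1]
    show "(\<lambda>x. - x i) \<in> measurable (Pi\<^sub>M I M) (M i)" .
  qed
  have "distr (Pi\<^sub>M I M) (Pi\<^sub>M I M) (compose I uminus) = Pi\<^sub>M I (\<lambda>i. distr (M i) (M i) uminus)"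
    by (rule distr_PiM_finite_prob_space'[OF fin]) (use prob_M M1 in auto)
  also have "(\<lambda>i. distr (M i) (M i) uminus) = M"
  proof
    fix i
    have "distr (M i) (M i) uminus = distr (M i) borel uminus" by (rule distr_cong) (auto simp: sets_M)
    then show "distr (M i) (M i) uminus = M i" using M[of i] distr_unit_measures_uminus by auto
  qed
  finally have D: "distr (Pi\<^sub>M I M) (Pi\<^sub>M I M) (compose I uminus) = Pi\<^sub>M I M" .
  have upd: "(compose I uminus x)(k := - s) = (\<lambda>i\<in>insert k I. - (x(k := s)) i)"
    "x(k := s) = (\<lambda>i\<in>insert k I. - ((compose I uminus x)(k := - s)) i)" if "x \<in> extensional I" for x
    using that k by (auto simp: fun_eq_iff compose_def restrict_def extensional_def)
  have "(compose I uminus x)(k := - s) \<in> B \<longleftrightarrow> x(k := s) \<in> B" if "x \<in> extensional I" for x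
    using upd[OF that] sym by metis
  then have "compose I uminus -` {x \<in> space (Pi\<^sub>M I M). x(k := - s) \<in> B} \<inter> space (Pi\<^sub>M I M) =
      {x \<in> space (Pi\<^sub>M I M). x(k := s) \<in> B}"
    by (auto simp: space_PiM_M compose_def)
  moreover have "section_measure (- s) = measure (distr (Pi\<^sub>M I M) (Pi\<^sub>M I M) (compose I uminus))
      {x \<in> space (Pi\<^sub>M I M). x(k := - s) \<in> B}"
    unfolding D section_measure_def ..
  ultimately show ?thesis
    unfolding section_measure_def by (simp add: measure_distr[OF meas section_sets])
qed

text \<open>A point \<open>s\<close> between \<open>t\<close> and \<open>- t\<close> is a convex
  combination of the two. The Prekopa-Leindler inequality for the indicators of the sections bounds
  the measure at \<open>s\<close> below by a geometric mean of the measures at \<open>t\<close> and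
  \<open>- t\<close>, which coincide.\<close>

lemma section_measure_unimodal:
  assumes "\<bar>s\<bar> \<le> \<bar>t\<bar>"
  shows "section_measure t \<le> section_measure s"
proof (cases "\<bar>s\<bar> = \<bar>t\<bar>")
  case True
  then have "s = t \<or> s = - t" by linarith
  then show ?thesis using section_measure_uminus by auto
next
  case False
  \<comment> \<open>The weight is the solution of \<open>s = (1 - l) * t + l * - t\<close>.\<close>
  define l where "l = (1 - s / t) / 2"
  have t: "t \<noteq> 0" using assms False by auto
  then have "\<bar>s / t\<bar> < 1" using assms False by (simp add: abs_divide)
  then have "s / t < 1" "- 1 < s / t" by linarith+
  then have l: "0 < l" "l < 1" by (simp_all add: l_def)
  have st: "s = (1 - l) * t + l * - t" using t by (simp add: l_def field_simps)
  let ?f = "\<lambda>u x. indicator {x. x(k := u) \<in> B} x :: real"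
  have int: "integral\<^sup>L (Pi\<^sub>M I M) (?f u) = section_measure u" for u
  proof -
    have "{x. x(k := u) \<in> B} \<inter> space (Pi\<^sub>M I M) = {x \<in> space (Pi\<^sub>M I M). x(k := u) \<in> B}" by auto
    then show ?thesis by (simp add: section_measure_def)
  qed
  have meas: "?f u \<in> borel_measurable (Pi\<^sub>M I M)" for u
    using section_sets[of u] by (simp add: borel_measurable_indicator_iff Int_def conj_commute)
  have "integral\<^sup>L (Pi\<^sub>M I M) (?f t) powr (1 - l) * integral\<^sup>L (Pi\<^sub>M I M) (?f (- t)) powr l
      \<le> integral\<^sup>L (Pi\<^sub>M I M) (?f s)"
  proof (rule prekopa_leindler_PiM[OF fin prob_M sets_M _ meas meas meas])
    show "prekopa_leindler l (M i)" for i
      using M[of i] prekopa_leindler_unit_uniform[OF l] prekopa_leindler_unit_gaussian[OF l] by auto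
    fix x y :: "'i \<Rightarrow> real" assume xy: "x \<in> extensional I" "y \<in> extensional I"
    let ?z = "\<lambda>i\<in>I. (1 - l) * x i + l * y i"
    have "?z(k := s) = (\<lambda>i\<in>insert k I. (1 - l) * (x(k := t)) i + l * (y(k := - t)) i)"
      using k st by (auto simp: fun_eq_iff restrict_def)
    then have "?z(k := s) \<in> B" if "x(k := t) \<in> B" "y(k := - t) \<in> B"
      using conv[OF that l] by simp
    then show "?f t x powr (1 - l) * ?f (- t) y powr l \<le> ?f s ?z"
      by (auto simp: indicator_def)
  qed auto
  moreover have "section_measure t powr (1 - l) * section_measure t powr l = section_measure t"
    by (simp add: section_measure_def flip: powr_add)
  ultimately show ?thesis by (simp only: int section_measure_uminus)
qed

lemma section_measure_range: "section_measure s \<in> {0..1}"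
proof -
  interpret P: prob_space "Pi\<^sub>M I M" by (rule prob_space_PiM) (rule prob_M)
  show ?thesis by (simp add: section_measure_def)
qed

text \<open>The law of coordinate \<open>k\<close> is left open, so that the Gaussian and the
  uniform choice are integrals of one and the same section function.\<close>

lemma product_measure_eq_integral_section:
  assumes "\<And>i. N i = unit_uniform \<or> N i = unit_gaussian" "\<And>i. i \<in> I \<Longrightarrow> N i = M i"
  shows "section_measure \<in> borel_measurable borel"
    "measure (Pi\<^sub>M (insert k I) N) B = integral\<^sup>L (N k) section_measure"
proof -
  have N: "prob_space (N i)" "sets (N i) = sets borel" for i using assms(1)[of i] by auto
  interpret product_sigma_finite N
    by (rule product_sigma_finite.intro) (rule prob_space_imp_sigma_finite[OF N(1)])
  interpret K: prob_space "N k" by (rule N)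
  interpret Q: prob_space "Pi\<^sub>M (insert k I) N" by (rule prob_space_PiM) (rule N)
  interpret P: prob_space "Pi\<^sub>M I M" by (rule prob_space_PiM) (rule prob_M)
  have NM: "Pi\<^sub>M I N = Pi\<^sub>M I M" by (rule PiM_cong) (use assms in auto)
  have BN [measurable]: "B \<in> sets (Pi\<^sub>M (insert k I) N)"
    using B sets_PiM_cong[of "insert k I" "insert k I" N "\<lambda>_. borel"] N by auto
  have sec: "(\<integral>\<^sup>+x. indicator B (x(k := s)) \<partial>Pi\<^sub>M I N) = ennreal (section_measure s)" for s
  proof -
    have "(\<integral>\<^sup>+x. indicator B (x(k := s)) \<partial>Pi\<^sub>M I N) =
        (\<integral>\<^sup>+x. indicator {x \<in> space (Pi\<^sub>M I M). x(k := s) \<in> B} x \<partial>Pi\<^sub>M I M)"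
      unfolding NM by (intro nn_integral_cong) (simp add: indicator_def)
    also have "\<dots> = ennreal (section_measure s)"
      by (simp add: section_sets section_measure_def P.emeasure_eq_measure)
    finally show ?thesis .
  qed
  interpret IN: prob_space "Pi\<^sub>M I N" by (rule prob_space_PiM) (rule N)
  have "(\<lambda>s. \<integral>\<^sup>+x. indicator B (x(k := s)) \<partial>Pi\<^sub>M I N) \<in> borel_measurable (N k)"
    by measurable
  then have "(\<lambda>s. enn2real (ennreal (section_measure s))) \<in> borel_measurable borel"
    unfolding sec by (simp add: measurable_cong_sets[OF N(2) refl])
  then show meas: "section_measure \<in> borel_measurable borel"
    using section_measure_range by simp
  have "emeasure (Pi\<^sub>M (insert k I) N) B = (\<integral>\<^sup>+x. indicator B x \<partial>Pi\<^sub>M (insert k I) N)"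
    by simp
  also have "\<dots> = (\<integral>\<^sup>+s. (\<integral>\<^sup>+x. indicator B (x(k := s)) \<partial>Pi\<^sub>M I N) \<partial>N k)"
    by (rule product_nn_integral_insert_rev[OF fin k]) measurable
  also have "\<dots> = ennreal (integral\<^sup>L (N k) section_measure)"
    unfolding sec
  proof (rule nn_integral_eq_integral)
    show "integrable (N k) section_measure"
      by (rule K.integrable_const_bound[of _ 1])
         (use section_measure_range meas in \<open>auto simp: measurable_cong_sets[OF N(2) refl]\<close>)
  qed (use section_measure_range in auto)
  finally show "measure (Pi\<^sub>M (insert k I) N) B = integral\<^sup>L (N k) section_measure"
    using section_measure_range by (simp add: measure_def integral_nonneg_AE)
qed

lemma measure_gaussian_coordinate_le:
  "measure (Pi\<^sub>M (insert k I) (M(k := unit_gaussian))) B \<le>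
   measure (Pi\<^sub>M (insert k I) (M(k := unit_uniform))) B"
proof -
  have k': "i \<in> I \<Longrightarrow> (M(k := X)) i = M i" for i X using k by auto
  have G: "(M(k := unit_gaussian)) i = unit_uniform \<or> (M(k := unit_gaussian)) i = unit_gaussian" for i
    using M by auto
  have U: "(M(k := unit_uniform)) i = unit_uniform \<or> (M(k := unit_uniform)) i = unit_gaussian" for i
    using M by auto
  have "integral\<^sup>L unit_gaussian section_measure \<le> integral\<^sup>L unit_uniform section_measure"
    by (rule integral_unit_gaussian_le_unit_uniform[OF product_measure_eq_integral_section(1)[OF M refl]
        section_measure_range section_measure_unimodal])
  then show ?thesis
    using product_measure_eq_integral_section(2)[of "M(k := unit_gaussian)", OF G k']
      product_measure_eq_integral_section(2)[of "M(k := unit_uniform)", OF U k'] by simp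
qed

end

text \<open>The laws are exchanged one coordinate at a time: \<open>J\<close> collects the
  coordinates that are already Gaussian, and enlarging \<open>J\<close> does not increase the
  measure of \<open>B\<close>.\<close>

lemma measure_PiM_gaussian_le_uniform:
  fixes B :: "('i \<Rightarrow> real) set"
  assumes fin: "finite I" and B: "B \<in> sets (Pi\<^sub>M I (\<lambda>_. borel))"
    and conv: "\<And>x y l. x \<in> B \<Longrightarrow> y \<in> B \<Longrightarrow> 0 < l \<Longrightarrow> l < 1 \<Longrightarrow>
      (\<lambda>i\<in>I. (1 - l) * x i + l * y i) \<in> B"
    and sym: "\<And>x. x \<in> B \<Longrightarrow> (\<lambda>i\<in>I. - x i) \<in> B"
  shows "measure (Pi\<^sub>M I (\<lambda>_. unit_gaussian)) B \<le> measure (Pi\<^sub>M I (\<lambda>_. unit_uniform)) B"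
proof -
  let ?M = "\<lambda>J i. if i \<in> J then unit_gaussian else unit_uniform"
  have "measure (Pi\<^sub>M I (?M J)) B \<le> measure (Pi\<^sub>M I (?M {})) B" if "J \<subseteq> I" for J
    using finite_subset[OF that fin] that
  proof (induction J rule: finite_induct)
    case (insert k J)
    have I: "insert k (I - {k}) = I" using insert.prems by auto
    interpret convex_symmetric_section "?M J" "I - {k}" k B
      by standard (unfold I, use fin B conv sym in auto)
    have "?M (insert k J) = (?M J)(k := unit_gaussian)" "?M J = (?M J)(k := unit_uniform)"
      using insert.hyps by (auto simp: fun_eq_iff)
    then have "measure (Pi\<^sub>M I (?M (insert k J))) B \<le> measure (Pi\<^sub>M I (?M J)) B"
      using measure_gaussian_coordinate_le unfolding I by simp
    also have "\<dots> \<le> measure (Pi\<^sub>M I (?M {})) B" using insert by simp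
    finally show ?case .
  qed simp
  from this[OF subset_refl] show ?thesis
    using PiM_cong[OF refl, of I "?M I" "\<lambda>_. unit_gaussian"] by simp
qed

text \<open>The product of the one-dimensional densities is a density of the product measure, which
  is checked on rectangles. Extensional functions on \<open>Basis\<close> are then identified with
  the vectors whose coordinates they are.\<close>

lemma emeasure_PiM_density:
  fixes w :: "real \<Rightarrow> ennreal" and S :: "'a::euclidean_space set"
  assumes [measurable]: "w \<in> borel_measurable borel" "S \<in> sets borel"
    and w: "(\<integral>\<^sup>+x. w x \<partial>lborel) = 1"
  shows "emeasure (Pi\<^sub>M (Basis :: 'a set) (\<lambda>_. density lborel w))
      {x \<in> extensional Basis. (\<Sum>b\<in>Basis. x b *\<^sub>R b) \<in> S} =
    (\<integral>\<^sup>+z. (\<Prod>b\<in>Basis. w (z \<bullet> b)) * indicator S z \<partial>lborel)"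
proof -
  let ?L = "Pi\<^sub>M (Basis :: 'a set) (\<lambda>_. lborel :: real measure)"
  let ?N = "\<lambda>_::'a. density lborel w"
  let ?\<psi> = "\<lambda>x. \<Sum>b\<in>Basis. x b *\<^sub>R b :: 'a"
  interpret L: product_sigma_finite "\<lambda>_::'a. lborel :: real measure" by standard
  have "prob_space (density lborel w)"
    by (intro prob_spaceI) (simp add: emeasure_density w)
  then interpret N: product_sigma_finite ?N
    by (intro product_sigma_finite.intro prob_space_imp_sigma_finite)
  have dens: "density ?L (\<lambda>x. \<Prod>b\<in>Basis. w (x b)) = Pi\<^sub>M Basis ?N"
  proof (rule N.PiM_eqI)
    show "sets (density ?L (\<lambda>x. \<Prod>b\<in>Basis. w (x b))) = sets (Pi\<^sub>M Basis ?N)"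
      by (simp cong: sets_PiM_cong)
    fix E :: "'a \<Rightarrow> real set" assume E: "\<And>b. b \<in> Basis \<Longrightarrow> E b \<in> sets (?N b)"
    then have E' [measurable]: "b \<in> Basis \<Longrightarrow> E b \<in> sets borel" for b by simp
    have "Pi\<^sub>E Basis E \<in> sets ?L" by (rule sets_PiM_I_finite) auto
    then have "emeasure (density ?L (\<lambda>x. \<Prod>b\<in>Basis. w (x b))) (Pi\<^sub>E Basis E) =
        (\<integral>\<^sup>+x. (\<Prod>b\<in>Basis. w (x b)) * indicator (Pi\<^sub>E Basis E) x \<partial>?L)"
      by (intro emeasure_density) measurable
    also have "\<dots> = (\<integral>\<^sup>+x. (\<Prod>b\<in>Basis. w (x b) * indicator (E b) (x b)) \<partial>?L)"
    proof (rule nn_integral_cong)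
      fix x assume "x \<in> space ?L"
      then have "x \<in> extensional Basis" by (simp add: space_PiM PiE_def)
      then have "(indicator (Pi\<^sub>E Basis E) x :: ennreal) = (\<Prod>b\<in>Basis. indicator (E b) (x b))"
        by (auto simp: indicator_def PiE_iff prod_zero_iff)
      then show "(\<Prod>b\<in>Basis. w (x b)) * indicator (Pi\<^sub>E Basis E) x =
          (\<Prod>b\<in>Basis. w (x b) * indicator (E b) (x b))"
        by (simp add: prod.distrib)
    qed
    also have "\<dots> = (\<Prod>b\<in>Basis. \<integral>\<^sup>+x. w x * indicator (E b) x \<partial>lborel)"
      by (rule L.product_nn_integral_prod) auto
    also have "\<dots> = (\<Prod>b\<in>Basis. emeasure (?N b) (E b))"
      by (intro prod.cong refl) (simp add: emeasure_density)
    finally show "emeasure (density ?L (\<lambda>x. \<Prod>b\<in>Basis. w (x b))) (Pi\<^sub>E Basis E) =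
        (\<Prod>b\<in>Basis. emeasure (?N b) (E b))" .
  qed simp
  have X: "{x \<in> extensional Basis. ?\<psi> x \<in> S} \<in> sets ?L"
  proof -
    have "?\<psi> \<in> measurable ?L borel" by measurable
    from measurable_sets[OF this assms(2)] show ?thesis
      by (simp add: space_PiM PiE_def vimage_def Int_def conj_commute)
  qed
  then have "emeasure (Pi\<^sub>M Basis ?N) {x \<in> extensional Basis. ?\<psi> x \<in> S} =
      (\<integral>\<^sup>+x. (\<Prod>b\<in>Basis. w (x b)) * indicator {x \<in> extensional Basis. ?\<psi> x \<in> S} x \<partial>?L)"
    unfolding dens[symmetric] by (intro emeasure_density) simp_all
  also have "\<dots> = (\<integral>\<^sup>+x. (\<Prod>b\<in>Basis. w (?\<psi> x \<bullet> b)) * indicator S (?\<psi> x) \<partial>?L)"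
    by (intro nn_integral_cong) (simp add: space_PiM PiE_def indicator_def inner_sum_left inner_Basis
        if_distrib cong: if_cong)
  also have "\<dots> = (\<integral>\<^sup>+z. (\<Prod>b\<in>Basis. w (z \<bullet> b)) * indicator S z \<partial>lborel)"
    by (subst (2) lborel_eq, subst nn_integral_distr) measurable
  finally show ?thesis .
qed

lemma prod_exp_inner_Basis:
  fixes z :: "'a::euclidean_space"
  shows "(\<Prod>b\<in>Basis. ennreal (exp (- (pi * (z \<bullet> b)\<^sup>2)))) = ennreal (exp (- (pi * (norm z)\<^sup>2)))"
  by (simp add: prod_ennreal exp_sum[symmetric] sum_negf sum_distrib_left[symmetric] norm_eq_sqrt_inner
      euclidean_inner[of z z] power2_eq_square[symmetric] sum_nonneg)

text \<open>This is the comparison of product measures read in the Euclidean space: the Gaussian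
  product has density \<open>exp (- (pi * (norm x)\<^sup>2))\<close>, the uniform product is
  Lebesgue measure on the centred unit cube.\<close>

lemma vaaler_convex_symmetric:
  fixes S :: "'a::euclidean_space set"
  assumes S: "S \<in> sets borel" and "convex S" and sym: "\<And>x. x \<in> S \<Longrightarrow> - x \<in> S"
  shows "(\<integral>\<^sup>+x. ennreal (exp (- (pi * (norm x)\<^sup>2))) * indicator S x \<partial>lborel) \<le>
    emeasure lborel (S \<inter> {x. \<forall>b\<in>Basis. \<bar>x \<bullet> b\<bar> \<le> 1/2})"
proof -
  let ?\<psi> = "\<lambda>x. \<Sum>b\<in>Basis. x b *\<^sub>R b :: 'a"
  let ?X = "{x \<in> extensional Basis. ?\<psi> x \<in> S}"
  let ?G = "Pi\<^sub>M (Basis :: 'a set) (\<lambda>_. unit_gaussian)" and ?U = "Pi\<^sub>M (Basis :: 'a set) (\<lambda>_. unit_uniform)"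
  have X: "?X \<in> sets (Pi\<^sub>M Basis (\<lambda>_. borel))"
  proof -
    have "?\<psi> \<in> measurable (Pi\<^sub>M Basis (\<lambda>_. borel)) borel" by measurable
    from measurable_sets[OF this S] show ?thesis
      by (simp add: space_PiM PiE_def vimage_def Int_def conj_commute)
  qed
  have "measure ?G ?X \<le> measure ?U ?X"
  proof (rule measure_PiM_gaussian_le_uniform[OF _ X])
    fix x y l assume "x \<in> ?X" "y \<in> ?X" "0 < l" "(l::real) < 1"
    then have "(1 - l) *\<^sub>R ?\<psi> x + l *\<^sub>R ?\<psi> y \<in> S" using convexD_alt[OF \<open>convex S\<close>] by simp
    then show "(\<lambda>i\<in>Basis. (1 - l) * x i + l * y i) \<in> ?X"
      by (simp add: scaleR_sum_right sum.distrib[symmetric] scaleR_add_left)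
  next
    fix x assume "x \<in> ?X"
    then have "- ?\<psi> x \<in> S" using sym by simp
    then show "(\<lambda>i\<in>Basis. - x i) \<in> ?X" by (simp add: sum_negf)
  qed simp
  moreover have "prob_space ?G" "prob_space ?U" by (auto intro!: prob_space_PiM)
  ultimately have "emeasure ?G ?X \<le> emeasure ?U ?X"
    by (simp add: prob_space.finite_measure finite_measure.emeasure_eq_measure)
  moreover have "emeasure ?G ?X = (\<integral>\<^sup>+x. ennreal (exp (- (pi * (norm x)\<^sup>2))) * indicator S x \<partial>lborel)"
    unfolding unit_gaussian_def
    by (subst emeasure_PiM_density) (simp_all add: S integral_gaussian_real prod_exp_inner_Basis)
  moreover have "emeasure ?U ?X = emeasure lborel (S \<inter> {x. \<forall>b\<in>Basis. \<bar>x \<bullet> b\<bar> \<le> 1/2})"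
  proof -
    let ?Q = "{x::'a. \<forall>b\<in>Basis. \<bar>x \<bullet> b\<bar> \<le> 1/2}"
    have Q: "?Q \<in> sets borel" by measurable
    have "(\<Prod>b\<in>Basis. ennreal (indicator {-1/2..1/2} (z \<bullet> b))) * indicator S z = indicator (S \<inter> ?Q) z" for z :: 'a
    proof (cases "z \<in> ?Q")
      case True
      then have "z \<bullet> b \<in> {-1/2..1/2}" if "b \<in> Basis" for b using that by (auto simp: abs_le_iff)
      then show ?thesis using True by (simp add: indicator_def)
    next
      case False
      then obtain b where b: "b \<in> Basis" "\<not> \<bar>z \<bullet> b\<bar> \<le> 1/2" by auto
      then have "z \<bullet> b \<notin> {-1/2..1/2}" by (auto simp: abs_le_iff)
      then have "(\<Prod>b\<in>Basis. ennreal (indicator {-1/2..1/2} (z \<bullet> b))) = 0"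
        using b by (intro prod_zero) (auto intro!: bexI[of _ b])
      then show ?thesis using False by simp
    qed
    then have "emeasure ?U ?X = (\<integral>\<^sup>+z. indicator (S \<inter> ?Q) z \<partial>lborel)"
      using emeasure_PiM_density[OF _ S, of "\<lambda>x. ennreal (indicator {-1/2..1/2} x)"]
      by (simp add: unit_uniform_def ennreal_indicator)
    then show ?thesis using S Q by (simp only: nn_integral_indicator sets_lborel sets.Int)
  qed
  ultimately show ?thesis by simp
qed

section \<open>Linear change of variables\<close>

lemma nn_integral_lborel_translate:
  fixes f :: "'a::euclidean_space \<Rightarrow> ennreal"
  assumes [measurable]: "f \<in> borel_measurable borel"
  shows "(\<integral>\<^sup>+x. f (x + t) \<partial>lborel) = (\<integral>\<^sup>+x. f x \<partial>lborel)"
proof -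
  have "(\<integral>\<^sup>+x. f x \<partial>lborel) = (\<integral>\<^sup>+x. f x \<partial>distr lborel borel ((+) t))"
    by (simp only: lborel_distr_plus)
  also have "\<dots> = (\<integral>\<^sup>+x. f (t + x) \<partial>lborel)" by (rule nn_integral_distr) auto
  finally show ?thesis by (simp add: add.commute)
qed

text \<open>By Fubini the coordinate \<open>b\<close> is integrated first. With the others fixed,
  among them \<open>b'\<close>, the shear is a translation in that coordinate.\<close>

lemma nn_integral_lborel_shear:
  fixes f :: "'a::euclidean_space \<Rightarrow> ennreal"
  assumes [measurable]: "f \<in> borel_measurable borel" and b: "b \<in> Basis" "b' \<in> Basis" "b \<noteq> b'"
  shows "(\<integral>\<^sup>+x. f (x + (c * (x \<bullet> b')) *\<^sub>R b) \<partial>lborel) = (\<integral>\<^sup>+x. f x \<partial>lborel)"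
proof -
  let ?L = "\<lambda>J::'a set. Pi\<^sub>M J (\<lambda>_. lborel :: real measure)"
  let ?\<psi> = "\<lambda>x. \<Sum>b\<in>Basis. x b *\<^sub>R b :: 'a"
  define J where "J = Basis - {b}"
  have J: "Basis = insert b J" "finite J" "b \<notin> J" "b' \<in> J" using b by (auto simp: J_def)
  interpret product_sigma_finite "\<lambda>_::'a. lborel :: real measure" by standard
  have \<psi>: "?\<psi> \<in> measurable (?L Basis) borel" by measurable
  have eq: "(\<integral>\<^sup>+z. g z \<partial>lborel) = (\<integral>\<^sup>+x. (\<integral>\<^sup>+s. g (?\<psi> (x(b := s))) \<partial>lborel) \<partial>?L J)"
    if [measurable]: "g \<in> borel_measurable borel" for g :: "'a \<Rightarrow> ennreal"
  proof -
    have "(\<integral>\<^sup>+z. g z \<partial>lborel) = (\<integral>\<^sup>+x. g (?\<psi> x) \<partial>?L Basis)"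
      by (subst lborel_eq, subst nn_integral_distr) measurable
    also have "\<dots> = (\<integral>\<^sup>+x. (\<integral>\<^sup>+s. g (?\<psi> (x(b := s))) \<partial>lborel) \<partial>?L J)"
      using product_nn_integral_insert[of J b "\<lambda>x. g (?\<psi> x)"] J(2,3) measurable_compose[OF \<psi> that]
      unfolding J(1)[symmetric] by simp
    finally show ?thesis .
  qed
  have upd: "?\<psi> (x(b := s)) = s *\<^sub>R b + (\<Sum>i\<in>J. x i *\<^sub>R i)" for x s
  proof -
    have "(\<Sum>i\<in>J. (x(b := s)) i *\<^sub>R i) = (\<Sum>i\<in>J. x i *\<^sub>R i)"
      by (rule sum.cong) (use J(3) in auto)
    then show ?thesis unfolding J(1) sum.insert[OF J(2,3)] by simp
  qed
  have "?\<psi> y \<bullet> b' = y b'" for y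
    using b by (simp add: inner_sum_left inner_Basis if_distrib cong: if_cong)
  then have coord: "?\<psi> (x(b := s)) \<bullet> b' = x b'" for x s using b by simp
  have shear: "?\<psi> (x(b := s)) + (c * (?\<psi> (x(b := s)) \<bullet> b')) *\<^sub>R b = ?\<psi> (x(b := s + c * x b'))" for x s
    unfolding coord unfolding upd by (simp add: algebra_simps)
  have tr: "(\<integral>\<^sup>+s. f (?\<psi> (x(b := s + c * x b'))) \<partial>lborel) = (\<integral>\<^sup>+s. f (?\<psi> (x(b := s))) \<partial>lborel)" for x
    by (rule nn_integral_lborel_translate[of "\<lambda>s. f (?\<psi> (x(b := s)))"]) (unfold upd, measurable)
  have "(\<integral>\<^sup>+x. f (x + (c * (x \<bullet> b')) *\<^sub>R b) \<partial>lborel) =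
      (\<integral>\<^sup>+x. (\<integral>\<^sup>+s. f (?\<psi> (x(b := s)) + (c * (?\<psi> (x(b := s)) \<bullet> b')) *\<^sub>R b) \<partial>lborel) \<partial>?L J)"
    by (rule eq) measurable
  also have "\<dots> = (\<integral>\<^sup>+x. (\<integral>\<^sup>+s. f (?\<psi> (x(b := s))) \<partial>lborel) \<partial>?L J)"
    by (simp only: shear tr)
  also have "\<dots> = (\<integral>\<^sup>+x. f x \<partial>lborel)" by (rule eq[symmetric]) measurable
  finally show ?thesis .
qed

lemma Basis_vec_eq: "Basis = range (\<lambda>i. axis i (1::real) :: real ^ 'n)"
  by (auto simp: Basis_vec_def)

lemma prod_Basis_vec:
  fixes f :: "real ^ 'n \<Rightarrow> 'a::comm_monoid_mult"
  shows "(\<Prod>b\<in>Basis. f b) = (\<Prod>i\<in>UNIV. f (axis i 1))"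
  unfolding Basis_vec_eq by (subst prod.reindex) (auto simp: inj_on_def axis_eq_axis)

text \<open>Lebesgue measure is determined by its values on boxes, and a permutation of coordinates
  only reorders the side lengths of a box.\<close>

lemma nn_integral_lborel_permute:
  fixes f :: "real ^ 'n \<Rightarrow> ennreal"
  assumes [measurable]: "f \<in> borel_measurable borel" and p: "p permutes UNIV"
  shows "(\<integral>\<^sup>+x. f (\<chi> i. x $ p i) \<partial>lborel) = (\<integral>\<^sup>+x. f x \<partial>lborel)"
proof -
  let ?T = "\<lambda>x::real^'n. \<chi> i. x $ p i"
  have lin: "linear ?T" by (rule linearI) (simp_all add: vec_eq_iff)
  then have [measurable]: "?T \<in> borel_measurable borel"
    by (intro borel_measurable_continuous_onI linear_continuous_on linear_conv_bounded_linear[THEN iffD1])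
  have "lborel = distr lborel borel ?T"
  proof (rule lborel_eqI)
    fix l u :: "real ^ 'n" assume le: "\<And>b. b \<in> Basis \<Longrightarrow> l \<bullet> b \<le> u \<bullet> b"
    let ?q = "inv p"
    have q: "p (?q i) = i" "?q (p i) = i" for i using permutes_inverses[OF p] by auto
    have le': "l $ i \<le> u $ i" for i
      using le[of "axis i 1"] by (auto simp: inner_axis Basis_vec_def)
    have "?T -` box l u = box (\<chi> i. l $ ?q i) (\<chi> i. u $ ?q i)"
      by (auto simp: mem_box_cart) (metis q)+
    then have "emeasure (distr lborel borel ?T) (box l u) =
        ennreal (\<Prod>b\<in>Basis. ((\<chi> i. u $ ?q i) - (\<chi> i. l $ ?q i)) \<bullet> b)"
      by (subst emeasure_distr, simp, simp, simp)
         (subst emeasure_lborel_box, auto simp: Basis_vec_def inner_axis le')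
    also have "(\<Prod>b\<in>Basis. ((\<chi> i. u $ ?q i) - (\<chi> i. l $ ?q i)) \<bullet> b) = (\<Prod>i\<in>UNIV. u $ ?q i - l $ ?q i)"
      by (simp add: prod_Basis_vec inner_axis)
    also have "\<dots> = (\<Prod>i\<in>UNIV. u $ i - l $ i)"
      by (rule prod.permute[OF permutes_inv[OF p], of "\<lambda>i. u $ i - l $ i", unfolded o_def, symmetric])
    also have "\<dots> = (\<Prod>b\<in>Basis. (u - l) \<bullet> b)"
      by (simp add: prod_Basis_vec inner_axis)
    finally show "emeasure (distr lborel borel ?T) (box l u) = ennreal (\<Prod>b\<in>Basis. (u - l) \<bullet> b)" .
  qed simp
  then have "(\<integral>\<^sup>+x. f x \<partial>lborel) = (\<integral>\<^sup>+x. f x \<partial>distr lborel borel ?T)" by simp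
  also have "\<dots> = (\<integral>\<^sup>+x. f (?T x) \<partial>lborel)" by (rule nn_integral_distr) auto
  finally show ?thesis by simp
qed

lemma matrix_vector_mult_borel [measurable]: "((*v) A :: real ^ 'n \<Rightarrow> real ^ 'm) \<in> borel_measurable borel"
  by (intro borel_measurable_continuous_onI continuous_intros)

text \<open>The formula is multiplicative in \<open>A\<close>, so elementary matrices suffice:
  diagonal matrices, transpositions and shears. A matrix with a zero row satisfies it
  vacuously.\<close>

lemma nn_integral_lborel_matrix:
  fixes A :: "real ^ 'n ^ 'n" and f :: "real ^ 'n \<Rightarrow> ennreal"
  assumes "det A \<noteq> 0" "f \<in> borel_measurable borel"
  shows "ennreal \<bar>det A\<bar> * (\<integral>\<^sup>+x. f (A *v x) \<partial>lborel) = (\<integral>\<^sup>+x. f x \<partial>lborel)"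
proof -
  define P where "P = (\<lambda>A :: real ^ 'n ^ 'n. det A \<noteq> 0 \<longrightarrow> (\<forall>f \<in> borel_measurable borel.
    ennreal \<bar>det A\<bar> * (\<integral>\<^sup>+x. f (A *v x) \<partial>lborel) = (\<integral>\<^sup>+x. f x \<partial>lborel)))"
  have "P A"
  proof (rule induct_matrix_elementary)
    fix A B :: "real ^ 'n ^ 'n" assume PA: "P A" and PB: "P B"
    show "P (A ** B)" unfolding P_def
    proof (intro impI ballI)
      fix f :: "real ^ 'n \<Rightarrow> ennreal" assume f [measurable]: "f \<in> borel_measurable borel"
      assume "det (A ** B) \<noteq> 0"
      then have nz: "det A \<noteq> 0" "det B \<noteq> 0" by (auto simp: det_mul)
      have "ennreal \<bar>det (A ** B)\<bar> * (\<integral>\<^sup>+x. f ((A ** B) *v x) \<partial>lborel) =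
          ennreal \<bar>det A\<bar> * (ennreal \<bar>det B\<bar> * (\<integral>\<^sup>+x. f (A *v (B *v x)) \<partial>lborel))"
        by (simp add: det_mul abs_mult ennreal_mult matrix_vector_mul_assoc mult.assoc)
      also have "\<dots> = ennreal \<bar>det A\<bar> * (\<integral>\<^sup>+x. f (A *v x) \<partial>lborel)"
        using PB[unfolded P_def, rule_format, OF nz(2) measurable_compose[OF matrix_vector_mult_borel f]]
        by simp
      also have "\<dots> = (\<integral>\<^sup>+x. f x \<partial>lborel)" using PA nz(1) f by (simp add: P_def)
      finally show "ennreal \<bar>det (A ** B)\<bar> * (\<integral>\<^sup>+x. f ((A ** B) *v x) \<partial>lborel) = (\<integral>\<^sup>+x. f x \<partial>lborel)" .
    qed
  next
    fix A :: "real ^ 'n ^ 'n" and i assume "row i A = 0"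
    then show "P A" by (simp add: P_def det_zero_row)
  next
    fix A :: "real ^ 'n ^ 'n" assume diag: "\<And>i j. i \<noteq> j \<Longrightarrow> A $ i $ j = 0"
    have det: "det A = (\<Prod>i\<in>UNIV. A $ i $ i)" by (rule det_diagonal) (rule diag)
    show "P A" unfolding P_def
    proof (intro impI ballI)
      fix f :: "real ^ 'n \<Rightarrow> ennreal" assume f [measurable]: "f \<in> borel_measurable borel"
      assume nz: "det A \<noteq> 0"
      \<comment> \<open>The diagonal entries as a function on \<open>Basis\<close>, the form in
        which \<open>lborel_affine_euclidean\<close> takes scaling factors.\<close>
      define c :: "real ^ 'n \<Rightarrow> real" where "c b = (A *v b) \<bullet> b" for b
      have c: "c (axis i 1) = A $ i $ i" for i
        by (simp add: c_def inner_axis matrix_vector_mult_basis column_def)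
      have T: "0 + (\<Sum>b\<in>Basis. (c b * (x \<bullet> b)) *\<^sub>R b) = A *v x" for x :: "real ^ 'n"
      proof -
        have "(\<Sum>b\<in>Basis. (c b * (x \<bullet> b)) *\<^sub>R b) = (\<Sum>i\<in>UNIV. (A $ i $ i * x $ i) *\<^sub>R axis i 1)"
          unfolding Basis_vec_eq by (subst sum.reindex) (auto simp: inj_on_def axis_eq_axis inner_axis c)
        also have "\<dots> = A *v x"
        proof -
          have "(\<Sum>j\<in>UNIV. A $ i $ j * x $ j) = A $ i $ i * x $ i" for i
            by (subst sum.remove[of _ i]) (auto simp: diag)
          then show ?thesis
            by (simp add: vec_eq_iff matrix_vector_mult_def axis_def if_distrib cong: if_cong)
        qed
        finally show ?thesis by simp
      qed
      have "(\<Prod>b\<in>Basis. \<bar>c b\<bar>) = \<bar>det A\<bar>"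
        by (simp add: prod_Basis_vec det c abs_prod)
      moreover have "c b \<noteq> 0" if "b \<in> Basis" for b
        using nz that c by (auto simp: det Basis_vec_eq)
      ultimately have "lborel = density (distr lborel borel ((*v) A)) (\<lambda>_. ennreal \<bar>det A\<bar>)"
        using lborel_affine_euclidean[of c 0] unfolding T by simp
      then have "(\<integral>\<^sup>+x. f x \<partial>lborel) = (\<integral>\<^sup>+x. f x \<partial>density (distr lborel borel ((*v) A)) (\<lambda>_. ennreal \<bar>det A\<bar>))"
        by simp
      also have "\<dots> = ennreal \<bar>det A\<bar> * (\<integral>\<^sup>+x. f (A *v x) \<partial>lborel)"
        by (simp add: nn_integral_density nn_integral_distr nn_integral_cmult)
      finally show "ennreal \<bar>det A\<bar> * (\<integral>\<^sup>+x. f (A *v x) \<partial>lborel) = (\<integral>\<^sup>+x. f x \<partial>lborel)" by simp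
    qed
  next
    fix m n :: 'n assume "m \<noteq> n"
    define p where "p = Transposition.transpose m n"
    have p: "p permutes UNIV" by (simp add: p_def permutes_swap_id)
    let ?A = "\<chi> i j. (mat 1 :: real ^ 'n ^ 'n) $ i $ p j"
    have pp: "p (p j) = j" for j by (simp add: p_def)
    have "(\<Sum>j\<in>UNIV. (if i = p j then 1 else 0) * x $ j) = (\<Sum>j\<in>UNIV. if j = p i then x $ j else 0)"
      for i and x :: "real ^ 'n"
      by (rule sum.cong[OF refl]) (use pp in auto)
    then have "?A *v x = (\<chi> i. x $ p i)" for x
      by (simp add: vec_eq_iff matrix_vector_mult_def mat_def)
    moreover have "\<bar>det ?A\<bar> = 1"
      using det_permute_columns[OF p, of "mat 1 :: real ^ 'n ^ 'n"] by (auto simp: sign_def split: if_splits)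
    ultimately have "P ?A" using nn_integral_lborel_permute[OF _ p] by (simp add: P_def)
    then show "P (\<chi> i j. mat 1 $ i $ Transposition.transpose m n j)" by (simp add: p_def)
  next
    fix m n :: 'n and c :: real assume mn: "m \<noteq> n"
    let ?A = "(\<chi> i j. if i = m \<and> j = n then c else of_bool (i = j)) :: real ^ 'n ^ 'n"
    have "?A = (\<chi> k. if k = m then row m (mat 1) + c *s row n (mat 1) else row k (mat 1))"
      using mn by (auto simp: vec_eq_iff row_def mat_def)
    then have det: "det ?A = 1" using det_row_operation[OF mn, of "mat 1" c] by simp
    have "?A *v x = x + (c * (x \<bullet> axis n 1)) *\<^sub>R axis m 1" for x
    proof -
      have "(\<Sum>j\<in>UNIV. (if i = m \<and> j = n then c else of_bool (i = j)) * x $ j) =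
          (\<Sum>j\<in>UNIV. if j = i then x $ j else 0) +
          (\<Sum>j\<in>UNIV. if j = n then (if i = m then c * x $ j else 0) else 0)" for i
        using mn by (subst sum.distrib[symmetric], intro sum.cong) auto
      then have "(\<Sum>j\<in>UNIV. (if i = m \<and> j = n then c else of_bool (i = j)) * x $ j) =
          x $ i + (if i = m then c * x $ n else 0)" for i
        by simp
      moreover have "((c * (x \<bullet> axis n 1)) *\<^sub>R axis m 1) $ i = (if i = m then c * x $ n else 0)" for i
        by (simp add: inner_axis) (simp add: axis_def)
      ultimately show ?thesis
        by (simp only: vec_eq_iff matrix_vector_mult_def vec_lambda_beta vector_add_component simp_thms)
    qed
    then show "P ?A"
      using nn_integral_lborel_shear[of _ "axis m (1::real)" "axis n (1::real)" c] mn det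
      by (auto simp: P_def Basis_vec_def axis_eq_axis)
  qed
  then show ?thesis using assms by (simp add: P_def)
qed

section \<open>Gaussian measure of slabs\<close>

lemma nn_integral_gaussian:
  "(\<integral>\<^sup>+x. ennreal (exp (- (pi * (norm x)\<^sup>2))) \<partial>(lborel :: 'a::euclidean_space measure)) = 1"
proof -
  have "(\<integral>\<^sup>+x. ennreal (exp (- (pi * (norm x)\<^sup>2))) \<partial>(lborel :: 'a measure)) =
      (\<integral>\<^sup>+x. (\<Prod>b\<in>Basis. ennreal (exp (- (pi * (x \<bullet> b)\<^sup>2)))) \<partial>(lborel :: 'a measure))" by (simp only: prod_exp_inner_Basis)
  also have "\<dots> = (\<Prod>b\<in>(Basis :: 'a set). (\<integral>\<^sup>+x. ennreal (exp (- (pi * x\<^sup>2))) \<partial>lborel))"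
    by (rule nn_integral_lborel_prod) auto
  finally show ?thesis by (simp add: integral_gaussian_real)
qed

text \<open>
  Both sides are compared with the double integral of \<open>g c * H x\<close> over \<open>q x + c \<in> E\<close>, where \<open>g\<close> is the
  Gaussian density on the target and \<open>H\<close>, the integrand below, is invariant under translations by
  the range of the adjoint \<open>p\<close> of \<open>q\<close>.
\<close>

lemma nn_integral_coisometry_fibre:
  fixes q :: "'a::euclidean_space \<Rightarrow> 'b::euclidean_space" and p :: "'b \<Rightarrow> 'a"
  assumes lin: "linear q" and qp: "\<And>c. q (p c) = c" and adj: "\<And>c x. p c \<bullet> x = c \<bullet> q x"
    and E [measurable]: "E \<in> sets borel"
  shows "(\<integral>\<^sup>+x. ennreal (exp (- (pi * ((norm x)\<^sup>2 - (norm (q x))\<^sup>2)))) * indicator E (q x) \<partial>lborel) =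
    emeasure lborel E"
proof -
  have [measurable]: "q \<in> borel_measurable borel"
    using lin by (intro borel_measurable_continuous_onI linear_continuous_on) (simp add: linear_conv_bounded_linear)
  define g :: "'b \<Rightarrow> ennreal" where "g c = ennreal (exp (- (pi * (norm c)\<^sup>2)))" for c
  define G :: "'a \<Rightarrow> ennreal" where "G x = ennreal (exp (- (pi * (norm x)\<^sup>2)))" for x
  define H :: "'a \<Rightarrow> ennreal" where "H x = ennreal (exp (- (pi * ((norm x)\<^sup>2 - (norm (q x))\<^sup>2))))" for x
  have [measurable]: "g \<in> borel_measurable borel" "G \<in> borel_measurable borel" "H \<in> borel_measurable borel"
    unfolding g_def G_def H_def by measurable
  have q: "q (x + p c) = q x + c" for x c using lin by (simp add: linear_add qp)
  have adj': "x \<bullet> p c = c \<bullet> q x" for x c using adj[of c x] by (simp add: inner_commute)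
  have H: "H (x + p c) = H x" for x c
  proof -
    have "(norm (x + p c))\<^sup>2 - (norm (q (x + p c)))\<^sup>2 = (norm x)\<^sup>2 - (norm (q x))\<^sup>2"
      unfolding q by (simp add: power2_norm_eq_inner inner_add_left inner_add_right adj adj' q qp
          inner_commute[of "q x" c])
    then show ?thesis by (simp only: H_def)
  qed
  have G: "g (q x) * H x = G x" for x
    by (simp add: g_def G_def H_def ennreal_mult'[symmetric] mult_exp_exp algebra_simps)
  define W where "W = (\<integral>\<^sup>+x. H x * indicator E (q x) \<partial>lborel)"
  \<comment> \<open>The Gaussian density has integral 1; inserting it as a factor creates the double
    integral.\<close>
  have "W = (\<integral>\<^sup>+c. g c \<partial>lborel) * W" by (simp add: g_def nn_integral_gaussian)
  also have "\<dots> = (\<integral>\<^sup>+c. g c * W \<partial>lborel)" by (rule nn_integral_multc[symmetric]) measurable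
  also have "\<dots> = (\<integral>\<^sup>+c. (\<integral>\<^sup>+x. g c * H x * indicator E (q x + c) \<partial>lborel) \<partial>lborel)"
  proof (rule nn_integral_cong)
    fix c
    have "W = (\<integral>\<^sup>+x. H (x + p c) * indicator E (q (x + p c)) \<partial>lborel)"
      unfolding W_def by (rule nn_integral_lborel_translate[symmetric]) measurable
    then show "g c * W = (\<integral>\<^sup>+x. g c * H x * indicator E (q x + c) \<partial>lborel)"
      by (simp add: H q nn_integral_cmult mult.assoc)
  qed
  also have "\<dots> = (\<integral>\<^sup>+x. (\<integral>\<^sup>+c. g c * H x * indicator E (q x + c) \<partial>lborel) \<partial>lborel)"
    by (rule lborel_pair.Fubini') measurable
  also have "\<dots> = (\<integral>\<^sup>+x. (\<integral>\<^sup>+c. G (x + p (- c)) * indicator E c \<partial>lborel) \<partial>lborel)"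
  proof (rule nn_integral_cong)
    fix x
    \<comment> \<open>Replacing \<open>c\<close> by \<open>c - q x\<close> frees the indicator from
      \<open>x\<close>, and \<open>g (c - q x) * H x\<close> becomes the full Gaussian density at
      \<open>x - p c\<close>.\<close>
    have "(\<integral>\<^sup>+c. g c * H x * indicator E (q x + c) \<partial>lborel) =
        (\<integral>\<^sup>+c. g (c + - q x) * H x * indicator E (q x + (c + - q x)) \<partial>lborel)"
      by (rule nn_integral_lborel_translate[symmetric]) measurable
    also have "\<dots> = (\<integral>\<^sup>+c. G (x + p (- c)) * indicator E c \<partial>lborel)"
    proof (rule nn_integral_cong)
      fix c
      have "g (c + - q x) = g (q (x + p (- c)))" by (simp add: q g_def norm_minus_commute)
      then show "g (c + - q x) * H x * indicator E (q x + (c + - q x)) = G (x + p (- c)) * indicator E c"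
        using G[of "x + p (- c)"] H[of x "- c"] by simp
    qed
    finally show "(\<integral>\<^sup>+c. g c * H x * indicator E (q x + c) \<partial>lborel) =
        (\<integral>\<^sup>+c. G (x + p (- c)) * indicator E c \<partial>lborel)" .
  qed
  also have "\<dots> = (\<integral>\<^sup>+c. (\<integral>\<^sup>+x. G (x + p (- c)) * indicator E c \<partial>lborel) \<partial>lborel)"
  proof (rule lborel_pair.Fubini')
    have "p = adjoint q" using adj by (intro adjoint_unique[symmetric]) (simp add: inner_commute)
    then have "linear p" using adjoint_linear[OF lin] by simp
    then have [measurable]: "p \<in> borel_measurable borel"
      by (intro borel_measurable_continuous_onI linear_continuous_on) (simp add: linear_conv_bounded_linear)
    show "(\<lambda>(c, x). G (x + p (- c)) * indicator E c) \<in> borel_measurable (lborel \<Otimes>\<^sub>M lborel)"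
      by measurable
  qed
  also have "\<dots> = (\<integral>\<^sup>+c. indicator E c \<partial>lborel)"
  proof (rule nn_integral_cong)
    fix c
    have "(\<integral>\<^sup>+x. G x \<partial>lborel) = 1" unfolding G_def by (rule nn_integral_gaussian)
    then have "(\<integral>\<^sup>+x. G (x + p (- c)) \<partial>lborel) = 1"
      using nn_integral_lborel_translate[of G "p (- c)"] by simp
    moreover have "(\<lambda>x. G (x + p (- c))) \<in> borel_measurable borel" by measurable
    ultimately show "(\<integral>\<^sup>+x. G (x + p (- c)) * indicator E c \<partial>lborel) = indicator E c"
      by (simp add: nn_integral_multc)
  qed
  finally show ?thesis by (simp add: W_def H_def)
qed

text \<open>Orthonormal coordinates on the row space of \<open>A\<close>: \<open>p\<close> maps
  isometrically onto it, its adjoint \<open>q\<close> is the orthogonal projection in these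
  coordinates, and \<open>B\<close> has the coordinates of the rows of \<open>A\<close> as rows. As
  inner products are preserved, \<open>A\<close> and \<open>B\<close> have the same Gram
  matrix.\<close>

lemma coisometry_factorization:
  fixes A :: "real ^ 'n ^ 'm"
  assumes "surj ((*v) A)"
  obtains q :: "real ^ 'n \<Rightarrow> real ^ 'm" and p and B :: "real ^ 'm ^ 'm"
  where "linear q" "\<And>c. q (p c) = c" "\<And>c x. p c \<bullet> x = c \<bullet> q x" "\<And>x. A *v x = B *v q x"
    "det B \<noteq> 0" "det (A ** transpose A) = (det B)\<^sup>2"
proof -
  have "dim (span (rows A)) = CARD('m)"
    using assms by (simp add: full_rank_surjective[symmetric] row_rank_def)
  then have "dim (UNIV :: (real ^ 'm) set) = dim (span (rows A))" by simp
  then obtain p :: "real ^ 'm \<Rightarrow> real ^ 'n" where p: "linear p" "p ` UNIV = span (rows A)"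
    "\<And>x. norm (p x) = norm x"
    using isometries_subspaces[of "UNIV :: (real ^ 'm) set" "span (rows A)"]
    by (metis UNIV_I subspace_UNIV subspace_span)
  define q where "q = adjoint p"
  have adj: "p c \<bullet> x = c \<bullet> q x" for c x unfolding q_def by (simp add: adjoint_works[OF p(1)])
  have inner: "p c \<bullet> p d = c \<bullet> d" for c d
    unfolding dot_norm by (simp add: p linear_add[OF p(1), symmetric])
  have qp: "q (p c) = c" for c
    by (rule vector_eq_rdot[THEN iffD1]) (metis adj inner inner_commute)
  have "\<forall>i. \<exists>r. row i A = p r"
  proof
    fix i
    have "row i A \<in> span (rows A)" by (rule span_base) (auto simp: rows_def)
    then show "\<exists>r. row i A = p r" using p(2) by auto
  qed
  then obtain r where r: "\<And>i. row i A = p (r i)" by metis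
  define B where "B = (\<chi> i. r i)"
  have Ax: "A *v x = B *v q x" for x
    by (simp add: vec_eq_iff matrix_vector_mul_component row_def[symmetric] B_def adj[symmetric] r[symmetric])
       (simp add: row_def)
  have "surj ((*v) B)" using assms Ax by (metis surj_def)
  then have "det B \<noteq> 0" by (simp add: matrix_right_invertible_surjective[symmetric] invertible_right_inverse[symmetric] invertible_det_nz)
  moreover have "A ** transpose A = B ** transpose B"
  proof -
    have "(A ** transpose A) $ i $ j = row i A \<bullet> row j A" for i j
      by (simp add: matrix_matrix_mult_def transpose_def row_def inner_vec_def)
    also have "\<dots> i j = (B ** transpose B) $ i $ j" for i j
      by (simp add: r inner) (simp add: matrix_matrix_mult_def transpose_def inner_vec_def B_def)
    finally show ?thesis by (simp add: vec_eq_iff)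
  qed
  then have "det (A ** transpose A) = (det B)\<^sup>2" by (simp add: det_mul det_transpose power2_eq_square)
  moreover have "linear q" unfolding q_def by (rule adjoint_linear[OF p(1)])
  ultimately show ?thesis using that[of q p B] qp adj Ax by blast
qed

text \<open>Vaaler's inequality bounds the volume below by the Gaussian measure of the slab. There
  \<open>q x\<close> lies in the small set \<open>E\<close>, so the Gaussian density loses at most
  the exponential factor against the integrand of \<open>nn_integral_coisometry_fibre\<close>, whose
  integral is the volume of \<open>E\<close>. As \<open>C\<close> is independent of \<eta>, the
  factor tends to 1 for thin slabs.\<close>

lemma cube_slab_measure_ge:
  fixes A :: "real ^ 'n ^ 'm"
  assumes "surj ((*v) A)"
  shows "\<exists>C. \<forall>\<eta>>0.
    ennreal (exp (- (pi * (C * \<eta>)\<^sup>2)) * (2 * \<eta>) ^ CARD('m) / sqrt (det (A ** transpose A))) \<le>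
    emeasure lborel ({x. \<forall>i. \<bar>(A *v x) $ i\<bar> < \<eta>} \<inter> {x. \<forall>j. \<bar>x $ j\<bar> \<le> 1/2})"
proof -
  obtain q :: "real ^ 'n \<Rightarrow> real ^ 'm" and p and B :: "real ^ 'm ^ 'm"
    where q: "linear q" "\<And>c. q (p c) = c" "\<And>c x. p c \<bullet> x = c \<bullet> q x"
      and AB: "\<And>x. A *v x = B *v q x" and det: "det B \<noteq> 0" "det (A ** transpose A) = (det B)\<^sup>2"
    using coisometry_factorization[OF assms] by metis
  from det(1) obtain B' where B': "B' ** B = mat 1" by (metis invertible_def invertible_det_nz)
  obtain K where K: "\<And>y. norm (B' *v y) \<le> K * norm y" "K > 0"
    using linear_bounded_pos[OF matrix_vector_mul_linear[of B']] by metis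
  \<comment> \<open>A vector with m entries below \<eta> has norm at most
    \<open>sqrt m * \<eta>\<close>, and the inverse of \<open>B\<close> enlarges norms at most by
    the factor \<open>K\<close>.\<close>
  define C where "C = K * sqrt (real CARD('m))"
  show ?thesis
  proof (intro exI[of _ C] allI impI)
    fix \<eta> :: real assume \<eta>: "0 < \<eta>"
    define Bx :: "(real ^ 'm) set" where "Bx = box (\<chi> i. - \<eta>) (\<chi> i. \<eta>)"
    define E where "E = (*v) B -` Bx"
    have Bx: "y \<in> Bx \<longleftrightarrow> (\<forall>i. \<bar>y $ i\<bar> < \<eta>)" for y by (auto simp: Bx_def mem_box_cart abs_less_iff minus_less_iff)
    have [measurable]: "Bx \<in> sets borel" "E \<in> sets borel"
      using measurable_sets[OF matrix_vector_mult_borel[of B], of Bx] by (auto simp: Bx_def E_def)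
    have volBx: "emeasure lborel Bx = ennreal ((2 * \<eta>) ^ CARD('m))"
    proof -
      have "emeasure lborel Bx = ennreal (\<Prod>b\<in>Basis. ((\<chi> i. \<eta>) - (\<chi> i. - \<eta>)) \<bullet> (b :: real ^ 'm))"
        unfolding Bx_def by (rule emeasure_lborel_box) (use \<eta> in \<open>auto simp: Basis_vec_def inner_axis\<close>)
      also have "(\<Prod>b\<in>Basis. ((\<chi> i. \<eta>) - (\<chi> i. - \<eta>)) \<bullet> (b :: real ^ 'm)) = (2 * \<eta>) ^ CARD('m)"
        by (simp add: prod_Basis_vec inner_axis)
      finally show ?thesis .
    qed
    have "ennreal \<bar>det B\<bar> * (\<integral>\<^sup>+x. indicator Bx (B *v x) \<partial>lborel) = (\<integral>\<^sup>+x. indicator Bx x \<partial>lborel)"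
      by (rule nn_integral_lborel_matrix[OF det(1)]) measurable
    moreover have "(\<integral>\<^sup>+x. indicator Bx (B *v x) \<partial>lborel) = (\<integral>\<^sup>+x. indicator E x \<partial>lborel)"
      by (simp only: E_def indicator_vimage o_def)
    ultimately have vol: "ennreal \<bar>det B\<bar> * emeasure lborel E = ennreal ((2 * \<eta>) ^ CARD('m))"
      by (simp add: volBx)
    have volE: "emeasure lborel E = ennreal ((2 * \<eta>) ^ CARD('m) / \<bar>det B\<bar>)"
    proof -
      have "emeasure lborel E = ennreal (1 / \<bar>det B\<bar>) * (ennreal \<bar>det B\<bar> * emeasure lborel E)"
        using det(1) by (simp add: mult.assoc[symmetric] ennreal_mult'[symmetric])
      also have "\<dots> = ennreal ((2 * \<eta>) ^ CARD('m) / \<bar>det B\<bar>)"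
        unfolding vol using \<eta> by (simp add: ennreal_mult'[symmetric])
      finally show ?thesis .
    qed
    have small: "norm y \<le> C * \<eta>" if "y \<in> E" for y
    proof -
      have By: "\<bar>(B *v y) $ i\<bar> < \<eta>" for i using that Bx by (auto simp: E_def)
      have "(norm (B *v y))\<^sup>2 = (\<Sum>i\<in>UNIV. ((B *v y) $ i)\<^sup>2)"
        by (simp add: norm_vec_def L2_set_def sum_nonneg)
      also have "\<dots> \<le> (\<Sum>i\<in>(UNIV::'m set). \<eta>\<^sup>2)"
      proof (rule sum_mono)
        fix i
        have "\<bar>(B *v y) $ i\<bar> \<le> \<bar>\<eta>\<bar>" using By[of i] \<eta> by simp
        then show "((B *v y) $ i)\<^sup>2 \<le> \<eta>\<^sup>2" by (simp only: abs_le_square_iff)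
      qed
      also have "\<dots> = (sqrt (real CARD('m)) * \<eta>)\<^sup>2" by (simp add: power_mult_distrib)
      finally have "norm (B *v y) \<le> sqrt (real CARD('m)) * \<eta>"
        by (rule power2_le_imp_le) (use \<eta> in simp)
      moreover have "norm y \<le> K * norm (B *v y)"
        using K(1)[of "B *v y"] by (simp add: matrix_vector_mul_assoc B')
      moreover have "K * norm (B *v y) \<le> K * (sqrt (real CARD('m)) * \<eta>)"
        using calculation(1) K(2) by (intro mult_left_mono) auto
      ultimately show ?thesis by (simp add: C_def mult.assoc)
    qed
    let ?S = "{x :: real ^ 'n. \<forall>i. \<bar>(A *v x) $ i\<bar> < \<eta>}"
    have S: "x \<in> ?S \<longleftrightarrow> q x \<in> E" for x by (simp add: E_def Bx AB)
    have [measurable]: "q \<in> borel_measurable borel"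
      using q(1) by (intro borel_measurable_continuous_onI linear_continuous_on) (simp add: linear_conv_bounded_linear)
    have Sm: "?S \<in> sets borel" by measurable
    have "ennreal (exp (- (pi * (C * \<eta>)\<^sup>2)) * (2 * \<eta>) ^ CARD('m) / sqrt (det (A ** transpose A))) =
        ennreal (exp (- (pi * (C * \<eta>)\<^sup>2))) * emeasure lborel E"
      unfolding volE det(2) by (simp add: ennreal_mult'[symmetric])
    also have "\<dots> = ennreal (exp (- (pi * (C * \<eta>)\<^sup>2))) *
        (\<integral>\<^sup>+x. ennreal (exp (- (pi * ((norm x)\<^sup>2 - (norm (q x))\<^sup>2)))) * indicator E (q x) \<partial>lborel)"
      by (subst nn_integral_coisometry_fibre[OF q]) auto
    also have "\<dots> = (\<integral>\<^sup>+x. ennreal (exp (- (pi * (C * \<eta>)\<^sup>2))) *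
        (ennreal (exp (- (pi * ((norm x)\<^sup>2 - (norm (q x))\<^sup>2)))) * indicator E (q x)) \<partial>lborel)"
      by (rule nn_integral_cmult[symmetric]) measurable
    also have "\<dots> \<le> (\<integral>\<^sup>+x. ennreal (exp (- (pi * (norm x)\<^sup>2))) * indicator ?S x \<partial>lborel)"
    proof (rule nn_integral_mono)
      fix x :: "real ^ 'n"
      show "ennreal (exp (- (pi * (C * \<eta>)\<^sup>2))) *
          (ennreal (exp (- (pi * ((norm x)\<^sup>2 - (norm (q x))\<^sup>2)))) * indicator E (q x)) \<le>
          ennreal (exp (- (pi * (norm x)\<^sup>2))) * indicator ?S x"
      proof (cases "q x \<in> E")
        case True
        then have "pi * (norm (q x))\<^sup>2 \<le> pi * (C * \<eta>)\<^sup>2"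
          using small by (intro mult_left_mono power_mono) auto
        then show ?thesis
          using True S[of x] by (simp add: ennreal_mult'[symmetric] mult_exp_exp algebra_simps)
      qed simp
    qed
    also have "\<dots> \<le> emeasure lborel (?S \<inter> {x. \<forall>b\<in>Basis. \<bar>x \<bullet> b\<bar> \<le> 1/2})"
    proof (rule vaaler_convex_symmetric[OF Sm])
      have "?S = (*v) A -` Bx" by (auto simp: Bx)
      then show "convex ?S" by (simp add: Bx_def convex_linear_vimage[OF matrix_vector_mul_linear])
      show "- x \<in> ?S" if "x \<in> ?S" for x
      proof -
        have "A *v (- x) = - (A *v x)" using linear_neg[OF matrix_vector_mul_linear] by blast
        then show ?thesis using that by simp
      qed
    qed
    also have "{x. \<forall>b\<in>Basis. \<bar>x \<bullet> b\<bar> \<le> 1/2} = {x :: real ^ 'n. \<forall>j. \<bar>x $ j\<bar> \<le> 1/2}"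
      by (auto simp: Basis_vec_def inner_axis)
    finally show "ennreal (exp (- (pi * (C * \<eta>)\<^sup>2)) * (2 * \<eta>) ^ CARD('m) / sqrt (det (A ** transpose A))) \<le>
      emeasure lborel (?S \<inter> {x. \<forall>j. \<bar>x $ j\<bar> \<le> 1/2})" .
  qed
qed

section \<open>Lattice points in slices of the cube\<close>

lemma card_vecs_in:
  fixes S :: "'a set"
  assumes "finite S"
  shows "finite {z :: 'a ^ 'k. \<forall>i. z $ i \<in> S}" "card {z :: 'a ^ 'k. \<forall>i. z $ i \<in> S} = card S ^ CARD('k)"
proof -
  have "bij_betw vec_nth {z :: 'a ^ 'k. \<forall>i. z $ i \<in> S} (Pi\<^sub>E UNIV (\<lambda>_. S))"
    by (rule bij_betw_byWitness[where f' = vec_lambda]) (auto simp: PiE_UNIV_domain)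
  moreover have "finite (Pi\<^sub>E (UNIV :: 'k set) (\<lambda>_. S))" "card (Pi\<^sub>E (UNIV :: 'k set) (\<lambda>_. S)) = card S ^ CARD('k)"
    using assms by (auto intro: finite_PiE simp: card_PiE)
  ultimately show "finite {z :: 'a ^ 'k. \<forall>i. z $ i \<in> S}" "card {z :: 'a ^ 'k. \<forall>i. z $ i \<in> S} = card S ^ CARD('k)"
    using bij_betw_finite bij_betw_same_card by metis+
qed

text \<open>The number of pairs \<open>(c, z)\<close> with \<open>u + z\<close> in
  \<open>B c\<close>, integrated over \<open>u\<close> in the unit cell \<open>Q\<close>, is at
  least the total volume. As \<open>Q\<close> has volume at most 1, some \<open>u\<close> has more
  than \<open>k\<close> pairs.\<close>

lemma blichfeldt_family:
  fixes B :: "'c \<Rightarrow> (real ^ 'n) set" and k :: nat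
  assumes C: "finite C" and B: "\<And>c. B c \<in> sets borel" "\<And>c. c \<in> C \<Longrightarrow> bounded (B c)"
    and large: "of_nat k < (\<Sum>c\<in>C. emeasure lborel (B c))"
  obtains u Z where "Z \<subseteq> C \<times> UNIV" "finite Z" "card Z = Suc k"
    "\<forall>(c, z)\<in>Z. u + vec_of_int z \<in> B c"
proof -
  define Q where "Q = {x :: real ^ 'n. \<forall>j. 0 \<le> x $ j \<and> x $ j < 1}"
  have [measurable]: "Q \<in> sets borel" unfolding Q_def by measurable
  note [measurable] = B(1)
  have volQ: "emeasure lborel Q \<le> 1"
  proof -
    have "Q \<subseteq> cbox 0 1" by (auto simp: Q_def mem_box_cart less_imp_le)
    then have "emeasure lborel Q \<le> emeasure lborel (cbox 0 (1 :: real ^ 'n))" by (rule emeasure_mono) simp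
    also have "\<dots> = 1" by (subst emeasure_lborel_cbox) (auto simp: Basis_vec_eq inner_axis prod_Basis_vec[unfolded Basis_vec_eq])
    finally show ?thesis .
  qed
  have "bounded (\<Union>c\<in>C. B c)" using C B(2) by (intro bounded_UN ballI)
  then obtain R where R: "\<And>c x. c \<in> C \<Longrightarrow> x \<in> B c \<Longrightarrow> norm x \<le> R" by (auto simp: bounded_iff)
  \<comment> \<open>A finite set containing the integer parts of all points of the bounded sets, so
    that only finite sums occur.\<close>
  define Z0 where "Z0 = {z :: int ^ 'n. \<forall>j. z $ j \<in> {\<lfloor>- R\<rfloor>..\<lfloor>R\<rfloor>}}"
  have Z0: "finite Z0" unfolding Z0_def by (rule card_vecs_in) simp
  have cover: "indicator (B c) x \<le> (\<Sum>z\<in>Z0. indicator (B c) x * indicator Q (x - vec_of_int z) :: ennreal)"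
    if c: "c \<in> C" for c x
  proof (cases "x \<in> B c")
    case True
    define z where "z = (\<chi> j. \<lfloor>x $ j\<rfloor>)"
    have "\<bar>x $ j\<bar> \<le> R" for j using component_le_norm_cart[of x j] R[OF c True] by linarith
    then have "z \<in> Z0" by (auto simp: Z0_def z_def abs_le_iff intro!: floor_mono) (simp add: minus_le_iff)
    moreover have "x - vec_of_int z \<in> Q" by (auto simp: Q_def z_def) linarith
    ultimately have "1 \<le> (\<Sum>z\<in>Z0. indicator Q (x - vec_of_int z) :: ennreal)"
      using Z0 by (subst sum.remove[of _ z]) auto
    then show ?thesis using True by simp
  qed simp
  define W where "W u = {(c, z). c \<in> C \<and> z \<in> Z0 \<and> u + vec_of_int z \<in> B c}" for u
  have W: "finite (W u)" for u
    by (rule finite_subset[of _ "C \<times> Z0"]) (use C Z0 in \<open>auto simp: W_def\<close>)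
  have cardW: "of_nat (card (W u)) = (\<Sum>c\<in>C. \<Sum>z\<in>Z0. indicator (B c) (u + vec_of_int z) :: ennreal)" for u
  proof -
    have "W u = {p \<in> C \<times> Z0. u + vec_of_int (snd p) \<in> B (fst p)}" by (auto simp: W_def)
    then have "of_nat (card (W u)) = (\<Sum>p\<in>C \<times> Z0. if u + vec_of_int (snd p) \<in> B (fst p) then 1 else 0 :: ennreal)"
      using C Z0 by (simp add: sum.If_cases Int_def)
    also have "\<dots> = (\<Sum>c\<in>C. \<Sum>z\<in>Z0. indicator (B c) (u + vec_of_int z))"
      by (simp add: sum.cartesian_product indicator_def of_bool_def case_prod_beta)
    finally show ?thesis .
  qed
  have "\<exists>u. k < card (W u)"
  proof (rule ccontr)
    assume "\<nexists>u. k < card (W u)"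
    then have small: "of_nat (card (W u)) \<le> (of_nat k :: ennreal)" for u by (simp add: not_less)
    have "(\<Sum>c\<in>C. emeasure lborel (B c)) = (\<Sum>c\<in>C. \<integral>\<^sup>+x. indicator (B c) x \<partial>lborel)" by simp
    also have "\<dots> \<le> (\<Sum>c\<in>C. \<integral>\<^sup>+x. (\<Sum>z\<in>Z0. indicator (B c) x * indicator Q (x - vec_of_int z)) \<partial>lborel)"
      by (intro sum_mono nn_integral_mono cover)
    also have "\<dots> = (\<Sum>c\<in>C. \<Sum>z\<in>Z0. \<integral>\<^sup>+x. indicator (B c) x * indicator Q (x - vec_of_int z) \<partial>lborel)"
      by (intro sum.cong refl nn_integral_sum) measurable
    also have "\<dots> = (\<Sum>c\<in>C. \<Sum>z\<in>Z0. \<integral>\<^sup>+x. indicator (B c) (x + vec_of_int z) * indicator Q x \<partial>lborel)"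
    proof (intro sum.cong refl)
      fix c z
      show "(\<integral>\<^sup>+x. indicator (B c) x * indicator Q (x - vec_of_int z) \<partial>lborel) =
          (\<integral>\<^sup>+x. indicator (B c) (x + vec_of_int z) * indicator Q x \<partial>lborel)"
        using nn_integral_lborel_translate[of "\<lambda>x. indicator (B c) x * indicator Q (x - vec_of_int z)" "vec_of_int z"]
        by simp
    qed
    also have "\<dots> = (\<integral>\<^sup>+x. (\<Sum>c\<in>C. \<Sum>z\<in>Z0. indicator (B c) (x + vec_of_int z) * indicator Q x) \<partial>lborel)"
      by (simp add: nn_integral_sum)
    also have "\<dots> = (\<integral>\<^sup>+x. of_nat (card (W x)) * indicator Q x \<partial>lborel)"
      unfolding cardW by (simp add: sum_distrib_right)
    also have "\<dots> \<le> (\<integral>\<^sup>+x. of_nat k * indicator Q x \<partial>lborel)"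
      by (intro nn_integral_mono mult_right_mono small) simp
    also have "\<dots> = of_nat k * emeasure lborel Q" by (simp add: nn_integral_cmult)
    also have "\<dots> \<le> of_nat k * 1" by (intro mult_left_mono volQ) simp
    finally show False using large by simp
  qed
  then obtain u where "Suc k \<le> card (W u)" by (auto simp: Suc_le_eq)
  then obtain Z where "Z \<subseteq> W u" "card Z = Suc k" "finite Z"
    by (metis obtain_subset_with_card_n)
  then show ?thesis by (intro that[of Z u]) (auto simp: W_def)
qed

lemma emeasure_lborel_scaleR:
  fixes S T :: "'a::euclidean_space set"
  assumes [measurable]: "S \<in> sets borel" "T \<in> sets borel" and c: "0 < c"
    and ST: "\<And>x. c *\<^sub>R x \<in> T \<longleftrightarrow> x \<in> S"
  shows "emeasure lborel T = ennreal (c ^ DIM('a)) * emeasure lborel S"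
proof -
  have "emeasure lborel T = emeasure (density (distr lborel borel (\<lambda>x. 0 + c *\<^sub>R x)) (\<lambda>_. ennreal (\<bar>c\<bar> ^ DIM('a)))) T"
    using lborel_affine[of c "0::'a"] c by simp
  also have "\<dots> = ennreal (c ^ DIM('a)) * emeasure lborel ((\<lambda>x. c *\<^sub>R x) -` T)"
    using c by (simp add: emeasure_density nn_integral_cmult emeasure_distr)
  also have "(\<lambda>x. c *\<^sub>R x) -` T = S" using ST by auto
  finally show ?thesis .
qed

text \<open>Blichfeldt's argument for the kernel lattice, carried out in the full integer lattice. A
  thin slab around the slice of the cube and its translates by \<open>a c\<close> are given to
  \<open>blichfeldt_family\<close>; the points found turn out to differ by kernel vectors. The loss
  \<open>e\<close> pays for the thickness of the slab.\<close>

lemma kernel_lattice_translate: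
  fixes A :: "int ^ 'n ^ 'm" and r e :: real and k :: nat
  assumes surj: "surj ((*v) (real_matrix A))" and mn: "CARD('m) \<le> CARD('n)" and r: "0 < r" and e: "0 < e"
    and large: "real k * sqrt (real_of_int (det (A ** transpose A))) < (2 * r) ^ (CARD('n) - CARD('m))"
  obtains w Z where "real_matrix A *v w = 0" "finite Z" "card Z = Suc k"
    "\<forall>z\<in>Z. A *v z = 0" "\<forall>z\<in>Z. \<forall>j. \<bar>w $ j + real_of_int (z $ j)\<bar> \<le> r + e"
proof -
  let ?A = "real_matrix A" and ?m = "CARD('m)" and ?n = "CARD('n)"
  define D where "D = sqrt (real_of_int (det (A ** transpose A)))"
  have "?A ** transpose ?A = real_matrix (A ** transpose A)"
    by (simp add: vec_eq_iff matrix_matrix_mult_def transpose_def map_matrix_def)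
  then have D: "sqrt (det (?A ** transpose ?A)) = D" by (simp add: D_def det_map_matrix_of_int)
  have Dpos: "D > 0"
    by (rule coisometry_factorization[OF surj]) (use D in auto)
  obtain C where C: "\<And>\<eta>. 0 < \<eta> \<Longrightarrow>
      ennreal (exp (- (pi * (C * \<eta>)\<^sup>2)) * (2 * \<eta>) ^ ?m / D) \<le>
      emeasure lborel ({x. \<forall>i. \<bar>(?A *v x) $ i\<bar> < \<eta>} \<inter> {x. \<forall>j. \<bar>x $ j\<bar> \<le> 1/2})"
    using cube_slab_measure_ge[OF surj] unfolding D by blast
  obtain Ri :: "real ^ 'm ^ 'n" where Ri: "?A ** Ri = mat 1"
    using surj matrix_right_invertible_surjective[of ?A] by auto
  have ARi: "?A *v (Ri *v c) = c" for c by (simp add: matrix_vector_mul_assoc Ri)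
  obtain K where K: "\<And>y. norm (Ri *v y) \<le> K * norm y" "K > 0"
    using linear_bounded_pos[OF matrix_vector_mul_linear[of Ri]] by metis
  have lim: "(\<lambda>q. exp (- (pi * (C * (1 / (2 * real q) / (2 * r)))\<^sup>2)) * (2 * r) ^ (?n - ?m))
      \<longlonglongrightarrow> exp (- (pi * (C * (0 / (2 * r)))\<^sup>2)) * (2 * r) ^ (?n - ?m)"
  proof -
    have "(\<lambda>q. (1 / 2) * (1 / real q)) \<longlonglongrightarrow> (1 / 2) * 0" by (intro tendsto_intros lim_1_over_n)
    then have "(\<lambda>q. 1 / (2 * real q)) \<longlonglongrightarrow> 0" by simp
    then show ?thesis using r by (intro tendsto_intros) auto
  qed
  have ev1: "\<forall>\<^sub>F q in sequentially.
      real k * D < exp (- (pi * (C * (1 / (2 * real q) / (2 * r)))\<^sup>2)) * (2 * r) ^ (?n - ?m)"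
    using large by (intro order_tendstoD(1)[OF lim]) (simp add: D_def)
  have ev2: "\<forall>\<^sub>F q in sequentially. K * (real ?m * (1 / (2 * real q))) \<le> e"
  proof -
    have "(\<lambda>q. K * real ?m / 2 * (1 / real q)) \<longlonglongrightarrow> K * real ?m / 2 * 0" by (intro tendsto_intros lim_1_over_n)
    then have "\<forall>\<^sub>F q in sequentially. K * real ?m / 2 * (1 / real q) < e"
      using e by (intro order_tendstoD(2)) auto
    then show ?thesis by (rule eventually_mono) (simp add: field_simps)
  qed
  \<comment> \<open>For large \<open>q\<close> the exponential factor is close enough to 1 to keep
    the strict inequality \<open>large\<close>, and the slab is thin enough for the final correction
    by \<open>e\<close>.\<close>
  obtain q :: nat where q0: "0 < q"
    and q1: "real k * D < exp (- (pi * (C * (1 / (2 * real q) / (2 * r)))\<^sup>2)) * (2 * r) ^ (?n - ?m)"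
    and q2: "K * (real ?m * (1 / (2 * real q))) \<le> e"
    using eventually_happens[OF eventually_conj[OF eventually_gt_at_top[of 0] eventually_conj[OF ev1 ev2]]]
    by auto
  define \<epsilon> where "\<epsilon> = 1 / (2 * real q)"
  have \<epsilon>: "\<epsilon> > 0" using q0 by (simp add: \<epsilon>_def)
  \<comment> \<open>Scaling by \<open>2 * r\<close> takes the unit cube to the cube of half-width
    \<open>r\<close> and thickness \<eta> to \<epsilon>.\<close>
  define \<eta> where "\<eta> = \<epsilon> / (2 * r)"
  have \<eta>: "\<eta> > 0" using \<epsilon> r by (simp add: \<eta>_def)
  let ?S = "{x. \<forall>i. \<bar>(?A *v x) $ i\<bar> < \<eta>} \<inter> {x. \<forall>j. \<bar>x $ j\<bar> \<le> 1/2}"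
  define B where "B = {x. \<forall>i. \<bar>(?A *v x) $ i\<bar> < \<epsilon>} \<inter> {x. \<forall>j. \<bar>x $ j\<bar> \<le> r}"
  have [measurable]: "?S \<in> sets borel" "B \<in> sets borel" unfolding B_def by measurable
  have volB: "ennreal (real k / real q ^ ?m) < emeasure lborel B"
  proof -
    have "emeasure lborel B = ennreal ((2 * r) ^ DIM(real ^ 'n)) * emeasure lborel ?S"
    proof (rule emeasure_lborel_scaleR)
      fix x :: "real ^ 'n"
      show "(2 * r) *\<^sub>R x \<in> B \<longleftrightarrow> x \<in> ?S"
        using r by (simp add: B_def \<eta>_def matrix_vector_mult_scaleR abs_mult field_simps)
    qed (use r in auto)
    moreover have "ennreal (real k / real q ^ ?m) <
        ennreal ((2 * r) ^ ?n * (exp (- (pi * (C * \<eta>)\<^sup>2)) * (2 * \<eta>) ^ ?m / D))"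
    proof -
      have pow1: "(2 * r) ^ ?n = (2 * r) ^ (?n - ?m) * (2 * r) ^ ?m"
        using mn by (simp only: power_add[symmetric] le_add_diff_inverse2)
      have pow2: "(2 * r) ^ ?m * (2 * \<eta>) ^ ?m = 1 / real q ^ ?m"
      proof -
        have "(2 * r) * (2 * \<eta>) = 1 / real q" using r q0 by (simp add: \<eta>_def \<epsilon>_def)
        then show ?thesis by (simp only: power_mult_distrib[symmetric] power_one_over)
      qed
      have eq: "(2 * r) ^ ?n * (exp (- (pi * (C * \<eta>)\<^sup>2)) * (2 * \<eta>) ^ ?m / D) =
          (exp (- (pi * (C * \<eta>)\<^sup>2)) * (2 * r) ^ (?n - ?m)) / D * (1 / real q ^ ?m)"
      proof -
        have "y * p * (x * z / D) = x * y / D * (p * z)" for x y z p :: real by simp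
        then show ?thesis by (simp only: pow1 pow2)
      qed
      have "real k < exp (- (pi * (C * \<eta>)\<^sup>2)) * (2 * r) ^ (?n - ?m) / D"
        using q1 Dpos by (simp add: \<eta>_def \<epsilon>_def pos_less_divide_eq)
      then have "real k * (1 / real q ^ ?m) <
          exp (- (pi * (C * \<eta>)\<^sup>2)) * (2 * r) ^ (?n - ?m) / D * (1 / real q ^ ?m)"
        using q0 by (intro mult_strict_right_mono) auto
      then show ?thesis unfolding eq by (intro ennreal_lessI) (auto intro: le_less_trans[rotated])
    qed
    moreover have "ennreal ((2 * r) ^ ?n * (exp (- (pi * (C * \<eta>)\<^sup>2)) * (2 * \<eta>) ^ ?m / D)) \<le>
        ennreal ((2 * r) ^ ?n) * emeasure lborel ?S"
      using C[OF \<eta>] r by (subst ennreal_mult') (auto intro: mult_left_mono)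
    ultimately show ?thesis by simp
  qed
  \<comment> \<open>The translates have \<open>A\<close>-values in cubes of side
    \<open>1 / q\<close> around \<open>c / q\<close>. Modulo integer vectors these fill the torus up
    to boundaries, so q^m slabs together recover the volume lost by thinness.\<close>
  define G where "G = {c :: int ^ 'm. \<forall>i. c $ i \<in> {0..<int q}}"
  have G: "finite G" "card G = q ^ ?m" using card_vecs_in[of "{0..<int q}"] by (auto simp: G_def)
  define a where "a c = Ri *v ((1 / real q) *\<^sub>R vec_of_int c)" for c
  define F where "F c = {x. x - a c \<in> B}" for c
  have Fm: "F c \<in> sets borel" for c unfolding F_def by measurable
  have bB: "bounded B"
  proof -
    have "B \<subseteq> cbox (\<chi> j. - r) (\<chi> j. r)" by (auto simp: B_def mem_box_cart abs_le_iff minus_le_iff)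
    then show ?thesis using bounded_cbox bounded_subset by blast
  qed
  have Fb: "bounded (F c)" for c
  proof -
    have "F c = (\<lambda>x. a c + x) ` B" by (force simp: F_def image_iff)
    then show ?thesis using bounded_translation[OF bB] by simp
  qed
  have volF: "emeasure lborel (F c) = emeasure lborel B" for c
  proof -
    have "(\<integral>\<^sup>+x. indicator B (x + - a c) \<partial>lborel) = (\<integral>\<^sup>+x. indicator B x \<partial>lborel)"
      by (rule nn_integral_lborel_translate) measurable
    moreover have "indicator B (x + - a c) = (indicator (F c) x :: ennreal)" for x
      by (simp add: F_def indicator_def)
    ultimately show ?thesis using Fm[of c] by simp
  qed
  have volsum: "of_nat k < (\<Sum>c\<in>G. emeasure lborel (F c))"
  proof -
    have "of_nat k = ennreal (real q ^ ?m) * ennreal (real k / real q ^ ?m)"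
      using q0 by (simp add: ennreal_mult'[symmetric] ennreal_of_nat_eq_real_of_nat)
    also have "\<dots> < ennreal (real q ^ ?m) * emeasure lborel B"
      using volB q0 by (intro ennreal_mult_strict_left_mono) auto
    also have "\<dots> = (\<Sum>c\<in>G. emeasure lborel (F c))"
      by (simp add: volF G(2) ennreal_of_nat_eq_real_of_nat)
    finally show ?thesis .
  qed
  obtain u Z where Z: "Z \<subseteq> G \<times> UNIV" "finite Z" "card Z = Suc k"
    and "\<forall>(c, z)\<in>Z. u + vec_of_int z \<in> F c"
    by (rule blichfeldt_family[OF G(1) Fm Fb volsum])
  then have uZ: "u + vec_of_int z \<in> F c" if "(c, z) \<in> Z" for c z
    using that by auto
  have AF: "\<bar>(?A *v u) $ i + real_of_int ((A *v z) $ i) - real_of_int (c $ i) / real q\<bar> < \<epsilon>"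
    if "(c, z) \<in> Z" for c z i
  proof -
    have "?A *v (u + vec_of_int z - a c) = ?A *v u + vec_of_int (A *v z) - (1 / real q) *\<^sub>R vec_of_int c"
      by (simp add: matrix_vector_mult_diff_distrib matrix_vector_right_distrib a_def ARi real_matrix_mult_vec_of_int)
    moreover have "\<bar>(?A *v (u + vec_of_int z - a c)) $ i\<bar> < \<epsilon>" using uZ[OF that] by (simp add: F_def B_def)
    ultimately show ?thesis by simp
  qed
  \<comment> \<open>Both values deviate by less than \<epsilon> = 1/(2q), so a multiple of 1/q has
    absolute value below 1/q and vanishes. Then \<open>c\<close> and \<open>c'\<close> agree modulo
    \<open>q\<close>, hence agree, as their entries lie in [0, q).\<close>
  have same: "c = c' \<and> A *v z = A *v z'" if 1: "(c, z) \<in> Z" and 2: "(c', z') \<in> Z" for c z c' z'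
  proof -
    have "c $ i = c' $ i \<and> (A *v z) $ i = (A *v z') $ i" for i
    proof -
      define t where "t = (A *v z) $ i - (A *v z') $ i"
      have "\<bar>real_of_int t - real_of_int (c $ i - c' $ i) / real q\<bar> < 2 * \<epsilon>"
        using AF[OF 1, of i] AF[OF 2, of i] by (simp add: t_def diff_divide_distrib)
      then have "real q * \<bar>real_of_int t - real_of_int (c $ i - c' $ i) / real q\<bar> < real q * (2 * \<epsilon>)"
        using q0 by simp
      then have "\<bar>real q * (real_of_int t - real_of_int (c $ i - c' $ i) / real q)\<bar> < 1"
        using q0 by (simp add: abs_mult \<epsilon>_def)
      then have "\<bar>real_of_int (int q * t - (c $ i - c' $ i))\<bar> < 1"
      proof -
        have "real q * (real_of_int t - real_of_int x / real q) = real_of_int (int q * t - x)" for x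
          using q0 by (simp add: right_diff_distrib)
        with \<open>\<bar>real q * _\<bar> < 1\<close> show ?thesis by (simp only:)
      qed
      then have eq: "int q * t = c $ i - c' $ i" by linarith
      have "c $ i \<in> {0..<int q}" "c' $ i \<in> {0..<int q}" using 1 2 Z(1) by (auto simp: G_def)
      then have "\<bar>int q * t\<bar> < int q * 1" unfolding eq by auto
      then have "\<bar>t\<bar> < 1" using q0 by (simp add: abs_mult)
      then show ?thesis using eq by (simp add: t_def)
    qed
    then show ?thesis by (simp add: vec_eq_iff)
  qed
  obtain c0 z0 where cz0: "(c0, z0) \<in> Z" using Z(3) by (metis card.empty ex_in_conv nat.distinct(1) surj_pair)
  define w0 where "w0 = u + vec_of_int z0 - a c0"
  \<comment> \<open>\<open>A *v w0\<close> has entries below \<epsilon>. Subtracting a preimage of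
    it, with entries at most \<open>e\<close>, moves \<open>w0\<close> into the kernel.\<close>
  define w where "w = w0 - Ri *v (?A *v w0)"
  define Y where "Y = (\<lambda>p. snd p - z0) ` Z"
  have w0B: "\<bar>(?A *v w0) $ i\<bar> < \<epsilon>" for i using uZ[OF cz0] by (simp add: w0_def F_def B_def)
  have corr: "\<bar>(Ri *v (?A *v w0)) $ j\<bar> \<le> e" for j
  proof -
    have "norm (?A *v w0) \<le> (\<Sum>i\<in>UNIV. \<bar>(?A *v w0) $ i\<bar>)" by (rule norm_le_l1_cart)
    also have "\<dots> \<le> (\<Sum>i\<in>(UNIV :: 'm set). \<epsilon>)" using w0B by (intro sum_mono less_imp_le)
    finally have "norm (?A *v w0) \<le> real ?m * \<epsilon>" by simp
    then have "K * norm (?A *v w0) \<le> K * (real ?m * \<epsilon>)" using K(2) by (intro mult_left_mono) auto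
    then show ?thesis
      using component_le_norm_cart[of "Ri *v (?A *v w0)" j] K(1)[of "?A *v w0"] q2 by (simp add: \<epsilon>_def)
  qed
  show ?thesis
  proof (rule that[of w Y], safe)
    show "?A *v w = 0" by (simp add: w_def matrix_vector_mult_diff_distrib ARi)
    show "finite Y" using Z by (simp add: Y_def)
    have "inj_on (\<lambda>p. snd p - z0) Z" using same by (auto simp: inj_on_def)
    then show "card Y = Suc k" using Z by (simp add: Y_def card_image)
    fix z assume "z \<in> Y"
    then obtain c z' where cz: "(c, z') \<in> Z" "z = z' - z0" by (auto simp: Y_def)
    then have c: "c = c0" "A *v z' = A *v z0" using same[OF cz(1) cz0] by auto
    then show "A *v z = 0" by (simp add: cz matrix_vector_mult_diff_distrib)
    fix j
    have "u + vec_of_int z' - a c0 \<in> B" using uZ[OF cz(1)] c by (simp add: F_def)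
    then have "\<bar>w0 $ j + real_of_int (z $ j)\<bar> \<le> r" by (simp add: B_def w0_def cz) (metis add.commute add_diff_eq diff_add_eq)
    then show "\<bar>w $ j + real_of_int (z $ j)\<bar> \<le> r + e"
      using corr[of j] by (simp add: w_def)
  qed
qed

section \<open>The diagonal Frobenius number\<close>

text \<open>Let \<open>z0\<close> be an integer preimage of the right-hand side. The kernel vector
  \<open>x - z0 + w\<close> is rounded to a lattice vector \<open>l\<close>, and the
  \<open>s\<close> points \<open>z0 + l + z\<close> then differ from \<open>x\<close> in each
  coordinate by at most the rounding error plus the size of \<open>w + z\<close>, together at most
  \<open>t\<close>.\<close>

lemma feasible_of_large_preimage:
  fixes A :: "int ^ 'n ^ 'm" and x :: "real ^ 'n" and s :: nat and t :: real
  assumes mn: "CARD('m) < CARD('n)" and s: "1 \<le> s" and gcd: "Gcd (maximal_minors A) = 1"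
    and b: "real_matrix A *v x \<in> int_vecs"
    and t: "(real CARD('n) - real CARD('m)) / 2 * sqrt (real_of_int (det (A ** transpose A))) +
      (real s - 1) powr (1 / (real CARD('n) - real CARD('m))) / 2 *
      sqrt (real_of_int (det (A ** transpose A))) powr (1 / (real CARD('n) - real CARD('m))) < t"
    and x: "\<And>j. t \<le> x $ j"
  shows "real_matrix A *v x \<in> feasible_set s A"
proof -
  let ?A = "real_matrix A"
  define D where "D = sqrt (real_of_int (det (A ** transpose A)))"
  define d where "d = CARD('n) - CARD('m)"
  have d: "d > 0" "real CARD('n) - real CARD('m) = real d" using mn by (simp_all add: d_def)
  have minor: "\<bar>real_of_int (det (\<chi> i j. A $ i $ g j))\<bar> \<le> D" if "inj g" for g :: "'m \<Rightarrow> 'n"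
  proof -
    have "(real_of_int (det (\<chi> i j. A $ i $ g j)))\<^sup>2 \<le> real_of_int (det (A ** transpose A))"
      using minor_squared_le_det_gram[OF that, of A] by (simp flip: of_int_power)
    then show ?thesis unfolding D_def by (rule real_le_rsqrt[of "\<bar>_\<bar>", unfolded power2_abs])
  qed
  have D0: "D \<ge> 0" using minor_squared_le_det_gram order_trans[OF zero_le_power2] gcd
    by (metis D_def nonzero_minor_of_Gcd_maximal_minors of_int_0_le_iff real_sqrt_ge_zero)
  obtain f :: "'m \<Rightarrow> 'n" where f: "inj f" "det (\<chi> i j. A $ i $ f j) \<noteq> 0"
    using nonzero_minor_of_Gcd_maximal_minors[OF gcd] by metis
  \<comment> \<open>\<open>N\<close> is the d-th root of \<open>(s - 1) * D\<close>, the threshold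
    for \<open>2 * r\<close> in Blichfeldt's argument, and \<open>N / 2\<close> is the second term
    of the bound. For \<open>s = 1\<close> it is 0, since \<open>0 powr x\<close> is 0.\<close>
  define N where "N = (real s - 1) powr (1 / real d) * D powr (1 / real d)"
  have N0: "N \<ge> 0" by (simp add: N_def)
  have Nd: "N ^ d = (real s - 1) * D"
  proof -
    have "N = ((real s - 1) * D) powr (1 / real d)" using s D0 by (simp add: N_def powr_mult)
    moreover have "0 \<le> (real s - 1) * D" using s D0 by simp
    ultimately show ?thesis using d(1)
      by (cases "(real s - 1) * D = 0") (auto simp: powr_realpow[symmetric] powr_powr)
  qed
  \<comment> \<open>Half of the slack in \<open>t\<close>: one \<open>e\<close> makes
    \<open>2 * r\<close> exceed \<open>N\<close> strictly, the other is the loss in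
    \<open>kernel_lattice_translate\<close>.\<close>
  define e where "e = (t - real d / 2 * D - N / 2) / 2"
  have e: "e > 0" using t unfolding d(2) D_def[symmetric] e_def N_def by simp
  define r where "r = N / 2 + e"
  have r: "r > 0" using N0 e by (simp add: r_def)
  have surj: "surj ((*v) ?A)"
  proof (rule surjI)
    \<comment> \<open>Real surjectivity follows by combining integer preimages of the unit
      vectors.\<close>
    show "?A *v (\<Sum>i\<in>UNIV. c $ i *\<^sub>R vec_of_int (SOME z. A *v z = axis i 1)) = c" for c
    proof -
      have "A *v (SOME z. A *v z = axis i 1) = axis i 1" for i
        by (rule someI_ex) (metis surjective_of_Gcd_maximal_minors[OF gcd])
      then have "?A *v (\<Sum>i\<in>UNIV. c $ i *\<^sub>R vec_of_int (SOME z. A *v z = axis i 1)) =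
          (\<Sum>i\<in>UNIV. c $ i *\<^sub>R vec_of_int (axis i 1))"
        by (simp add: linear_sum[OF matrix_vector_mul_linear] matrix_vector_mult_scaleR real_matrix_mult_vec_of_int)
      also have "\<dots> = c" by (simp add: vec_eq_iff axis_def if_distrib cong: if_cong)
      finally show ?thesis .
    qed
  qed
  have large: "real (s - 1) * sqrt (real_of_int (det (A ** transpose A))) < (2 * r) ^ (CARD('n) - CARD('m))"
  proof -
    have "real (s - 1) * D = N ^ d" using s by (simp add: Nd of_nat_diff)
    also have "\<dots> < (2 * r) ^ d" using N0 e d(1) by (intro power_strict_mono) (auto simp: r_def)
    finally show ?thesis by (simp add: d_def D_def)
  qed
  obtain w Z where w: "?A *v w = 0" and Z: "finite Z" "card Z = Suc (s - 1)"
    and AZ: "\<forall>z\<in>Z. A *v z = 0" and wZ: "\<forall>z\<in>Z. \<forall>j. \<bar>w $ j + real_of_int (z $ j)\<bar> \<le> r + e"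
    by (rule kernel_lattice_translate[OF surj less_imp_le[OF mn] r e large])
  from b obtain b' where b': "?A *v x = vec_of_int b'" by (auto simp: int_vecs_eq)
  obtain z0 where z0: "A *v z0 = b'" using surjective_of_Gcd_maximal_minors[OF gcd] by metis
  have ker: "?A *v (x - vec_of_int z0 + w) = 0"
    by (simp add: matrix_vector_right_distrib matrix_vector_mult_diff_distrib w b' real_matrix_mult_vec_of_int z0)
  obtain l where l: "A *v l = 0"
    "\<forall>j. \<bar>(x - vec_of_int z0 + w) $ j - real_of_int (l $ j)\<bar> \<le> real d / 2 * D"
    by (rule kernel_lattice_rounding[OF f minor ker, unfolded d(2)])
  let ?P = "fiber_polyhedron A (?A *v x) \<inter> int_vecs"
  define Y where "Y = (\<lambda>z. vec_of_int (z0 + l + z)) ` Z"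
  have "inj_on (\<lambda>z. vec_of_int (z0 + l + z)) Z" by (auto simp: inj_on_def)
  then have "card Y = s" using Z s by (simp add: Y_def card_image)
  moreover have "Y \<subseteq> ?P"
  proof
    fix p assume "p \<in> Y"
    then obtain z where z: "z \<in> Z" and p: "p = vec_of_int (z0 + l + z)" by (auto simp: Y_def)
    have "A *v (z0 + l + z) = b'" by (simp add: matrix_vector_right_distrib AZ[rule_format, OF z] l z0)
    then have "?A *v p = ?A *v x" by (simp only: p real_matrix_mult_vec_of_int b')
    moreover have "0 \<le> p $ j" for j
    proof -
      have "p $ j - x $ j =
          (w $ j + real_of_int (z $ j)) - ((x - vec_of_int z0 + w) $ j - real_of_int (l $ j))"
        by (simp add: p)
      moreover have "t = real d / 2 * D + (r + e)" by (simp add: r_def e_def field_simps)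
      ultimately show ?thesis
        using wZ[rule_format, OF z, of j] l(2)[rule_format, of j] x[of j] by linarith
    qed
    moreover have "p \<in> int_vecs" unfolding p int_vecs_eq by (rule rangeI)
    ultimately show "p \<in> ?P" by (simp add: fiber_polyhedron_def)
  qed
  ultimately have "infinite ?P \<or> s \<le> card ?P" using card_mono by blast
  then show ?thesis using b by (simp add: feasible_set_def)
qed

section \<open>The column cone and its translates\<close>

lemma column_cone_nonneg_combination:
  fixes A :: "int ^ 'n ^ 'm"
  assumes "y \<in> column_cone A"
  obtains c where "\<And>j. 0 \<le> c $ j" "y = real_matrix A *v c"
proof -
  let ?S = "{real_matrix A *v c |c. \<forall>j. 0 \<le> c $ j}"
  have "column_cone A \<subseteq> ?S"
    unfolding column_cone_def
  proof (rule hull_minimal)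
    show "columns (real_matrix A) \<subseteq> ?S"
    proof
      fix v assume "v \<in> columns (real_matrix A)"
      then obtain j where "v = column j (real_matrix A)" by (auto simp: columns_def)
      then have "v = real_matrix A *v axis j 1" by (simp add: matrix_vector_mult_basis)
      then show "v \<in> ?S" by (auto intro!: exI[of _ "axis j 1"] simp: axis_def)
    qed
    show "convex_cone ?S"
      unfolding convex_cone_iff
    proof (intro conjI ballI allI impI)
      show "0 \<in> ?S" by (auto intro!: exI[of _ 0])
      fix u v assume "u \<in> ?S" "v \<in> ?S"
      then obtain c c' where "u = real_matrix A *v c" "v = real_matrix A *v c'" "\<forall>j. 0 \<le> c $ j" "\<forall>j. 0 \<le> c' $ j"
        by auto
      then show "u + v \<in> ?S"
        by (auto intro!: exI[of _ "c + c'"] simp: matrix_vector_right_distrib)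
    next
      fix u :: "real ^ 'm" and a :: real assume "u \<in> ?S" "0 \<le> a"
      then obtain c where "u = real_matrix A *v c" "\<forall>j. 0 \<le> c $ j" by auto
      then show "a *\<^sub>R u \<in> ?S"
        using \<open>0 \<le> a\<close> by (auto intro!: exI[of _ "a *\<^sub>R c"] simp: matrix_vector_mult_scaleR)
    qed
  qed
  then show ?thesis using assms that by blast
qed

text \<open>The image of the all-ones vector is the sum of the columns and so belongs to the cone.
  Hence the translates \<open>t v + C\<close> shrink as \<open>t\<close> grows.\<close>

lemma column_cone_add_ones:
  assumes "y \<in> column_cone A" "0 \<le> a"
  shows "a *\<^sub>R (real_matrix A *v 1) + y \<in> column_cone A"
proof -
  have cone: "convex_cone (column_cone A)" unfolding column_cone_def by (rule convex_cone_convex_cone_hull)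
  have col: "column j (real_matrix A) \<in> column_cone A" for j
    unfolding column_cone_def by (rule hull_inc) (auto simp: columns_def)
  have "(\<Sum>j\<in>J. column j (real_matrix A)) \<in> column_cone A" if "finite J" for J
    using that by induction (use cone col in \<open>auto simp: convex_cone_iff\<close>)
  moreover have "real_matrix A *v 1 = (\<Sum>j\<in>UNIV. column j (real_matrix A))"
    by (simp add: matrix_mult_sum)
  ultimately have "real_matrix A *v 1 \<in> column_cone A" by simp
  then show ?thesis using cone assms by (auto simp: convex_cone_iff)
qed

text \<open>The interior is open, so \<open>b - h v\<close> still belongs to it for small
  \<open>h\<close>. This supplies the strict slack at the bound and shows that the minimum is
  attained.\<close>

lemma interior_translate_shift:
  fixes v :: "'a::real_normed_vector"
  assumes "b \<in> interior ((\<lambda>x. t *\<^sub>R v + x) ` C)"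
  obtains h where "0 < h" "b \<in> interior ((\<lambda>x. (t + h) *\<^sub>R v + x) ` C)"
proof -
  let ?U = "interior ((\<lambda>x. t *\<^sub>R v + x) ` C)"
  have "open ((\<lambda>h. b - h *\<^sub>R v) -` ?U)" by (intro open_vimage continuous_intros) simp
  moreover have "0 \<in> (\<lambda>h. b - h *\<^sub>R v) -` ?U" using assms by simp
  ultimately obtain d where d: "d > 0" "ball 0 d \<subseteq> (\<lambda>h. b - h *\<^sub>R v) -` ?U"
    by (metis open_contains_ball)
  define h where "h = d / 2"
  have h: "0 < h" "h \<in> ball 0 d" using d(1) by (simp_all add: h_def)
  then have "b - h *\<^sub>R v \<in> ?U" using d(2) by blast
  then have "b \<in> (\<lambda>x. h *\<^sub>R v + x) ` ?U" by (intro image_eqI[of _ _ "b - h *\<^sub>R v"]) auto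
  also have "\<dots> = interior ((\<lambda>x. h *\<^sub>R v + x) ` (\<lambda>x. t *\<^sub>R v + x) ` C)"
    by (rule interior_translation[symmetric])
  also have "(\<lambda>x. h *\<^sub>R v + x) ` (\<lambda>x. t *\<^sub>R v + x) ` C = (\<lambda>x. (t + h) *\<^sub>R v + x) ` C"
    by (simp add: image_image algebra_simps)
  finally show ?thesis using that h by blast
qed

theorem theorem1p2:
  fixes A :: "int ^ 'n ^ 'm" and s :: nat
  assumes "CARD('m) < CARD('n)"
    and "1 \<le> s"
    and "Gcd (maximal_minors A) = 1"
    and "{x :: real ^ 'n. (\<forall>j. 0 \<le> x $ j) \<and> real_matrix A *v x = 0} = {0}"
  shows "diagonal_frobenius s A \<le>
    (real CARD('n) - real CARD('m)) / 2 * sqrt (real_of_int (det (A ** transpose A))) +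
    (real s - 1) powr (1 / (real CARD('n) - real CARD('m))) / 2 *
      sqrt (real_of_int (det (A ** transpose A))) powr (1 / (real CARD('n) - real CARD('m)))"
proof -
  define \<beta> where "\<beta> =
    (real CARD('n) - real CARD('m)) / 2 * sqrt (real_of_int (det (A ** transpose A))) +
    (real s - 1) powr (1 / (real CARD('n) - real CARD('m))) / 2 *
      sqrt (real_of_int (det (A ** transpose A))) powr (1 / (real CARD('n) - real CARD('m)))"
  define v where "v = real_matrix A *v 1"
  define U where "U t = interior ((\<lambda>x. t *\<^sub>R v + x) ` column_cone A)" for t
  \<comment> \<open>\<open>Least\<close> is meaningful only if a least element exists, so besides
    the bound \<beta> also the infimum must be shown to lie in \<open>T\<close>.\<close>
  define T where "T = {t. 0 \<le> t \<and> U t \<inter> int_vecs \<subseteq> feasible_set s A}"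
  have shift: "\<exists>h>0. b \<in> U (t + h)" if "b \<in> U t" for b t
    using interior_translate_shift[of b t v "column_cone A"] that unfolding U_def by metis
  have anti: "U t' \<subseteq> U t" if "t \<le> t'" for t t'
    unfolding U_def
  proof (rule interior_mono, clarify)
    fix y assume "y \<in> column_cone A"
    then have "(t' - t) *\<^sub>R v + y \<in> column_cone A" using that column_cone_add_ones unfolding v_def by fastforce
    then show "t' *\<^sub>R v + y \<in> (\<lambda>x. t *\<^sub>R v + x) ` column_cone A"
      by (intro image_eqI[of _ _ "(t' - t) *\<^sub>R v + y"]) (auto simp: algebra_simps)
  qed
  have "\<beta> \<in> T"
  proof -
    have "0 \<le> det (A ** transpose A)"
    proof (rule nonzero_minor_of_Gcd_maximal_minors[OF assms(3)])
      fix f :: "'m \<Rightarrow> 'n" assume "inj f"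
      from minor_squared_le_det_gram[OF this, of A] show ?thesis by (rule order_trans[OF zero_le_power2])
    qed
    then have "0 \<le> \<beta>" using assms(1) by (simp add: \<beta>_def)
    moreover have "b \<in> feasible_set s A" if b: "b \<in> U \<beta>" "b \<in> int_vecs" for b
    proof -
      \<comment> \<open>The shift by \<open>h\<close> gives the strict inequality that
        \<open>feasible_of_large_preimage\<close> demands.\<close>
      obtain h where h: "h > 0" "b \<in> U (\<beta> + h)" using shift[OF b(1)] by auto
      then obtain y where y: "y \<in> column_cone A" "b = (\<beta> + h) *\<^sub>R v + y"
        using interior_subset unfolding U_def by blast
      obtain c where c: "\<And>j. 0 \<le> c $ j" "y = real_matrix A *v c"
        using column_cone_nonneg_combination[OF y(1)] by metis
      have bx: "b = real_matrix A *v ((\<beta> + h) *\<^sub>R 1 + c)"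
        by (simp add: y c v_def matrix_vector_right_distrib matrix_vector_mult_scaleR)
      show ?thesis unfolding bx
      proof (rule feasible_of_large_preimage[OF assms(1-3)])
        show "real_matrix A *v ((\<beta> + h) *\<^sub>R 1 + c) \<in> int_vecs" using b(2) bx by simp
        show "\<beta> + h \<le> ((\<beta> + h) *\<^sub>R 1 + c) $ j" for j using c(1)[of j] by simp
      qed (use h(1) in \<open>simp only: \<beta>_def[symmetric] less_add_same_cancel1\<close>)
    qed
    ultimately show ?thesis by (auto simp: T_def)
  qed
  have bdd: "bdd_below T" by (auto simp: T_def intro: bdd_belowI[of _ 0])
  have "Inf T \<in> T"
  proof -
    have "0 \<le> Inf T" using \<open>\<beta> \<in> T\<close> by (intro cInf_greatest) (auto simp: T_def)
    moreover have "b \<in> feasible_set s A" if b: "b \<in> U (Inf T)" "b \<in> int_vecs" for b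
    proof -
      \<comment> \<open>Some \<open>t\<close> in \<open>T\<close> lies below
        \<open>Inf T + h\<close>, and \<open>U\<close> is decreasing, so \<open>b\<close> already
        lies in \<open>U t\<close>.\<close>
      obtain h where h: "h > 0" "b \<in> U (Inf T + h)" using shift[OF b(1)] by auto
      then obtain t where t: "t \<in> T" "t < Inf T + h"
        using cInf_lessD[of T "Inf T + h"] \<open>\<beta> \<in> T\<close> by auto
      then have "b \<in> U t" using anti[of t "Inf T + h"] h(2) by auto
      then show ?thesis using t b(2) by (auto simp: T_def)
    qed
    ultimately show ?thesis by (auto simp: T_def)
  qed
  then have "(LEAST t. t \<in> T) = Inf T"
    by (rule Least_equality) (rule cInf_lower[OF _ bdd])
  then have "diagonal_frobenius s A = Inf T"
    by (simp add: diagonal_frobenius_def T_def U_def v_def)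
  also have "\<dots> \<le> \<beta>" using \<open>\<beta> \<in> T\<close> bdd by (rule cInf_lower)
  finally show ?thesis by (simp only: \<beta>_def)
qed

end
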